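(* Let $p,q\in[1,\infty)$ satisfy $1<p\le q$ or $p=1<q$. Then the $(p,q)$-Poincaré constant $C_{p,q}:\mathcal X\to[0,\infty]$ is monotone, $1$-homogeneous and lower semicontinuous with respect to the box topology.
   Context: A pm-space is a triple $X=(X,d_X,m_X)$ with $(X,d_X)$ a complete separable metric space and $m_X$ a Borel probability measure. Two pm-spaces are isomorphic if there is an isometry $\operatorname{supp} m_X\to\operatorname{supp} m_Y$ pushing $m_X$ forward to $m_Y$; $\mathcal X$ is the set of isomorphism classes, and a class is always represented by a space with $\operatorname{supp}m_X=X$. Lipschitz order: $Y\prec X$ iff there is a $1$-Lipschitz map $\phi:X\to Y$ with $\phi_\#m_X=m_Y$. Box distance: a parameter of $X$ is a Borel map $a:[0,1]\to X$ with $a_\#\mathcal L^1=m_X$; $\square(X,Y)$ is the infimum of $\epsilon>0$ such that there are parameters $a$ of $X$, $b$ of $Y$ and a Borel set $I_0\subset[0,1]$ with $\mathcal L^1(I_0)\ge1-\epsilon$ and $|d_X(a(s),a(t))-d_Y(b(s),b(t))|\le\epsilon$ for all $s,t\in I_0$; it induces the box topology on $\mathcal X$. For $f:X\to\mathbb R$, $\mathrm{lip}_a(f)(x)=\lim_{r\to0}\mathrm{Lip}(f|_{B_r(x)})$, where $B_r(x)$ is the closed ball and $\mathrm{Lip}$ is the best Lipschitz constant ($0$ on one-point sets). $V_X^{(p)}(f)=\int_X|f-\int_Xf\,dm_X|^p\,dm_X$. $C_{p,q}(X)$ is the infimum of $C\in[0,\infty]$ such that $$V_X^{(p)}(f)^{1/p}\le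 C\Big(\int_X\mathrm{lip}_a(f)^q\,dm_X\Big)^{1/q}$$ for every bounded Lipschitz $f:X\to\mathbb R$ ($\inf\emptyset=\infty$). $F:\mathcal X\to[0,\infty]$ is monotone if $X\prec Y$ implies $F(X)\le F(Y)$, and $1$-homogeneous if $F(tX)=tF(X)$ for all $t>0$, where $tX=(X,td_X,m_X)$. *)

theory Defs
  imports "HOL-Probability.Probability"
begin

section \<open>pm-spaces\<close>

text \<open>A triple \<open>(X, d, m)\<close> is encoded as a pair of a library metric (which carries both the
  underlying set and the distance) and a measure.\<close>

type_synonym 'a pm = "'a metric \<times> 'a measure"

abbreviation pm_metric :: "'a pm \<Rightarrow> 'a metric" where "pm_metric \<equiv> fst"
abbreviation pm_measure :: "'a pm \<Rightarrow> 'a measure" where "pm_measure \<equiv> snd"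
abbreviation pm_points :: "'a pm \<Rightarrow> 'a set" where "pm_points X \<equiv> mspace (pm_metric X)"
abbreviation pm_dist :: "'a pm \<Rightarrow> 'a \<Rightarrow> 'a \<Rightarrow> real" where "pm_dist X \<equiv> mdist (pm_metric X)"

definition pm_space :: "'a pm \<Rightarrow> bool" where
  "pm_space X \<longleftrightarrow>
     mcomplete_of (pm_metric X) \<and>
     separable_space (mtopology_of (pm_metric X)) \<and>
     space (pm_measure X) = pm_points X \<and>
     sets (pm_measure X) =
       sigma_sets (pm_points X) {U. openin (mtopology_of (pm_metric X)) U} \<and>
     prob_space (pm_measure X)"

definition pm_supp :: "'a pm \<Rightarrow> 'a set" where
  "pm_supp X = {x \<in> pm_points X.
     \<forall>U. openin (mtopology_of (pm_metric X)) U \<and> x \<in> U \<longrightarrow> emeasure (pm_measure X) U > 0}"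

definition pm_iso :: "'a pm \<Rightarrow> 'b pm \<Rightarrow> bool" where
  "pm_iso X Y \<longleftrightarrow> (\<exists>\<phi>.
     \<phi> ` pm_supp X = pm_supp Y \<and>
     (\<forall>x\<in>pm_supp X. \<forall>y\<in>pm_supp X. pm_dist Y (\<phi> x) (\<phi> y) = pm_dist X x y) \<and>
     distr (restrict_space (pm_measure X) (pm_supp X)) (pm_measure Y) \<phi> = pm_measure Y)"

definition lipschitz_order :: "'b pm \<Rightarrow> 'a pm \<Rightarrow> bool" where
  "lipschitz_order Y X \<longleftrightarrow> (\<exists>\<phi>.
     \<phi> \<in> pm_points X \<rightarrow> pm_points Y \<and>
     (\<forall>x\<in>pm_points X. \<forall>y\<in>pm_points X. pm_dist Y (\<phi> x) (\<phi> y) \<le> pm_dist X x y) \<and>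
     distr (pm_measure X) (pm_measure Y) \<phi> = pm_measure Y)"

definition pm_scale :: "real \<Rightarrow> 'a pm \<Rightarrow> 'a pm" where
  "pm_scale t X = (metric (pm_points X, \<lambda>x y. t * pm_dist X x y), pm_measure X)"


section \<open>Box distance\<close>

abbreviation unit_lebesgue :: "real measure" where
  "unit_lebesgue \<equiv> restrict_space lborel {0..1}"

definition pm_parameter :: "'a pm \<Rightarrow> (real \<Rightarrow> 'a) \<Rightarrow> bool" where
  "pm_parameter X a \<longleftrightarrow>
     a \<in> measurable unit_lebesgue (pm_measure X) \<and>
     distr unit_lebesgue (pm_measure X) a = pm_measure X"

definition box_dist :: "'a pm \<Rightarrow> 'b pm \<Rightarrow> ennreal" where
  "box_dist X Y = Inf {ennreal \<epsilon> | \<epsilon>. \<epsilon> > 0 \<and>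
     (\<exists>a b I0. pm_parameter X a \<and> pm_parameter Y b \<and>
        I0 \<in> sets unit_lebesgue \<and> measure unit_lebesgue I0 \<ge> 1 - \<epsilon> \<and>
        (\<forall>s\<in>I0. \<forall>t\<in>I0. \<bar>pm_dist X (a s) (a t) - pm_dist Y (b s) (b t)\<bar> \<le> \<epsilon>))}"


section \<open>Poincare constants\<close>

text \<open>\<open>lip_const\<close> is only applied to functions that are Lipschitz on \<open>S\<close>, so that the infimum is
  taken over a nonempty set of reals.\<close>

definition lip_const :: "'a metric \<Rightarrow> 'a set \<Rightarrow> ('a \<Rightarrow> real) \<Rightarrow> real" where
  "lip_const m S f = Inf {L. 0 \<le> L \<and> (\<forall>x\<in>S. \<forall>y\<in>S. \<bar>f x - f y\<bar> \<le> L * mdist m x y)}"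

definition lip_a :: "'a metric \<Rightarrow> ('a \<Rightarrow> real) \<Rightarrow> 'a \<Rightarrow> real" where
  "lip_a m f x = Lim (at_right 0) (\<lambda>r. lip_const m (mcball_of m x r) f)"

definition pm_variance :: "real \<Rightarrow> 'a pm \<Rightarrow> ('a \<Rightarrow> real) \<Rightarrow> real" where
  "pm_variance p X f =
     (\<integral>x. \<bar>f x - (\<integral>y. f y \<partial>pm_measure X)\<bar> powr p \<partial>pm_measure X)"

definition bounded_lipschitz :: "'a metric \<Rightarrow> ('a \<Rightarrow> real) \<Rightarrow> bool" where
  "bounded_lipschitz m f \<longleftrightarrow>
     Lipschitz_continuous_map m euclidean_metric f \<and> bounded (f ` mspace m)"

text \<open>In \<^typ>\<open>ennreal\<close> the infimum of the empty set is \<open>\<infinity>\<close>. The library convention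
  \<open>\<infinity> * 0 = 0\<close> has no influence on the infimum: it only decides whether \<open>\<infinity>\<close> is admissible.\<close>

definition poincare_const :: "real \<Rightarrow> real \<Rightarrow> 'a pm \<Rightarrow> ennreal" where
  "poincare_const p q X = Inf {C :: ennreal. \<forall>f. bounded_lipschitz (pm_metric X) f \<longrightarrow>
     ennreal (pm_variance p X f powr (1 / p))
       \<le> C * ennreal ((\<integral>x. lip_a (pm_metric X) f x powr q \<partial>pm_measure X) powr (1 / q))}"


section \<open>Isomorphism classes\<close>

text \<open>To form the set of all isomorphism classes one carrier type has to be fixed. By Frechet's
  embedding \<open>x \<mapsto> (d x (s n))\<^sub>n\<close>, with \<open>s\<close> a dense sequence, every pm-space over an arbitrary type
  is isomorphic to one whose points are real sequences, with full support (lemma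
  \<open>pm_space_representable\<close> below).\<close>

type_synonym real_pm = "(nat \<Rightarrow> real) pm"

definition pm_iso_rel :: "(real_pm \<times> real_pm) set" where
  "pm_iso_rel = {(X, Y). pm_space X \<and> pm_space Y \<and> pm_iso X Y}"

definition pm_classes :: "real_pm set set" where
  "pm_classes = {X. pm_space X} // pm_iso_rel"

definition pm_class :: "'a pm \<Rightarrow> real_pm set" where
  "pm_class X = {Y. pm_space Y \<and> pm_iso X Y}"

definition pm_rep :: "real_pm set \<Rightarrow> real_pm" where
  "pm_rep \<X> = (SOME X. X \<in> \<X> \<and> pm_supp X = pm_points X)"

definition class_order :: "real_pm set \<Rightarrow> real_pm set \<Rightarrow> bool" where
  "class_order \<Y> \<X> \<longleftrightarrow> lipschitz_order (pm_rep \<Y>) (pm_rep \<X>)"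

definition class_scale :: "real \<Rightarrow> real_pm set \<Rightarrow> real_pm set" where
  "class_scale t \<X> = pm_class (pm_scale t (pm_rep \<X>))"

definition class_box_dist :: "real_pm set \<Rightarrow> real_pm set \<Rightarrow> ennreal" where
  "class_box_dist \<X> \<Y> = box_dist (pm_rep \<X>) (pm_rep \<Y>)"

definition class_poincare_const :: "real \<Rightarrow> real \<Rightarrow> real_pm set \<Rightarrow> ennreal" where
  "class_poincare_const p q \<X> = poincare_const p q (pm_rep \<X>)"

definition box_topology :: "real_pm set topology" where
  "box_topology = topology (\<lambda>U. U \<subseteq> pm_classes \<and>
     (\<forall>\<X>\<in>U. \<exists>r>0. {\<Y> \<in> pm_classes. class_box_dist \<X> \<Y> < ennreal r} \<subseteq> U))"


section \<open>Properties of functions on the set of classes\<close>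

definition class_monotone :: "(real_pm set \<Rightarrow> ennreal) \<Rightarrow> bool" where
  "class_monotone F \<longleftrightarrow>
     (\<forall>\<X>\<in>pm_classes. \<forall>\<Y>\<in>pm_classes. class_order \<X> \<Y> \<longrightarrow> F \<X> \<le> F \<Y>)"

definition class_1_homogeneous :: "(real_pm set \<Rightarrow> ennreal) \<Rightarrow> bool" where
  "class_1_homogeneous F \<longleftrightarrow>
     (\<forall>\<X>\<in>pm_classes. \<forall>t>0. F (class_scale t \<X>) = ennreal t * F \<X>)"

definition lower_semicontinuous :: "'a topology \<Rightarrow> ('a \<Rightarrow> ennreal) \<Rightarrow> bool" where
  "lower_semicontinuous T F \<longleftrightarrow> (\<forall>c. openin T {x \<in> topspace T. c < F x})"


section \<open>Well-definedness of the isomorphism classes and of the box topology\<close>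

lemma pm_second_countable:
  assumes "separable_space (mtopology_of m)"
  shows "second_countable (mtopology_of m)"
proof -
  obtain C where C: "countable C" "C \<subseteq> mspace m" "mtopology_of m closure_of C = mspace m"
    using assms unfolding separable_space_def by auto
  interpret Metric_space "mspace m" "mdist m" by simp
  have top: "mtopology_of m = mtopology" by (simp add: mtopology_of_def)
  define B where "B = (\<lambda>(c, n). mball c (1 / real (Suc n))) ` (C \<times> (UNIV :: nat set))"
  show ?thesis
    unfolding second_countable_def
  proof (intro exI[of _ B] conjI ballI allI impI)
    show "countable B" unfolding B_def using C(1) by (intro countable_image countable_SIGMA) auto
    show "openin (mtopology_of m) V" if "V \<in> B" for V
      using that unfolding B_def top by auto
    fix U x assume "openin (mtopology_of m) U \<and> x \<in> U"
    then obtain r where r: "r > 0" "mball x r \<subseteq> U" and x: "x \<in> mspace m"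
      unfolding top openin_mtopology by blast
    obtain n where n: "inverse (real (Suc n)) < r / 2"
      using reals_Archimedean[of "r/2"] r(1) by auto
    define e where "e = 1 / real (Suc n)"
    have e: "e > 0" "e < r / 2" using n by (auto simp: e_def inverse_eq_divide)
    have "x \<in> mtopology closure_of C" using C(3) x top by simp
    then obtain c where c: "c \<in> C" "c \<in> mball x e"
      using metric_closure_of[of C] e(1) by blast
    have "mball c e \<subseteq> mball x r"
    proof
      fix y assume y: "y \<in> mball c e"
      have "mdist m x y \<le> mdist m x c + mdist m c y" using x y c by (intro triangle) auto
      also have "\<dots> < r" using y c e by auto
      finally show "y \<in> mball x r" using x y by auto
    qed
    moreover have "x \<in> mball c e" using c x commute by auto
    moreover have "mball c e \<in> B" using c(1) by (auto simp: B_def e_def)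
    ultimately show "\<exists>V\<in>B. x \<in> V \<and> V \<subseteq> U" using r(2) by blast
  qed
qed

lemma openin_pm_sets:
  assumes "pm_space X" "openin (mtopology_of (pm_metric X)) U"
  shows "U \<in> sets (pm_measure X)"
  using assms unfolding pm_space_def by (auto intro: sigma_sets.Basic)

lemma pm_null_outside_supp:
  assumes X: "pm_space X"
  shows "openin (mtopology_of (pm_metric X)) (pm_points X - pm_supp X)"
    and "emeasure (pm_measure X) (pm_points X - pm_supp X) = 0"
proof -
  let ?T = "mtopology_of (pm_metric X)" and ?m = "pm_measure X"
  define N where "N = {U. openin ?T U \<and> emeasure ?m U = 0}"
  have eq: "pm_points X - pm_supp X = \<Union>N"
    using openin_subset[of ?T] by (fastforce simp: pm_supp_def N_def)
  show op: "openin ?T (pm_points X - pm_supp X)" unfolding eq by (auto simp: N_def)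
  have "second_countable ?T" using X unfolding pm_space_def by (simp add: pm_second_countable)
  then obtain B where B: "countable B" "\<And>V. V \<in> B \<Longrightarrow> openin ?T V"
      "\<And>U x. openin ?T U \<Longrightarrow> x \<in> U \<Longrightarrow> \<exists>V\<in>B. x \<in> V \<and> V \<subseteq> U"
    unfolding second_countable_def by metis
  have sub: "\<exists>V\<in>B \<inter> N. x \<in> V" if h: "x \<in> U" "U \<in> N" for x U
  proof -
    obtain V where V: "V \<in> B" "x \<in> V" "V \<subseteq> U" using B(3)[of U x] h unfolding N_def by blast
    have "emeasure ?m V \<le> emeasure ?m U"
      using V(3) openin_pm_sets[OF X] that by (intro emeasure_mono) (auto simp: N_def)
    then have "V \<in> N" using B(2) V(1) that by (auto simp: N_def)
    then show ?thesis using V by auto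
  qed
  have "\<Union>N = \<Union>(B \<inter> N)" using sub by blast
  moreover have "(\<Union>V\<in>B \<inter> N. V) \<in> null_sets ?m"
    using B(1) openin_pm_sets[OF X]
    by (intro null_sets_UN') (auto simp: N_def null_sets_def)
  ultimately show "emeasure ?m (pm_points X - pm_supp X) = 0" unfolding eq by auto
qed

lemma pm_supp_subset: "pm_supp X \<subseteq> pm_points X"
  by (auto simp: pm_supp_def)

lemma pm_supp_sets:
  assumes X: "pm_space X"
  shows "pm_supp X \<in> sets (pm_measure X)"
proof -
  have "space (pm_measure X) - (pm_points X - pm_supp X) \<in> sets (pm_measure X)"
    by (intro sets.compl_sets openin_pm_sets[OF X] pm_null_outside_supp(1)[OF X])
  then show ?thesis using X pm_supp_subset[of X] by (auto simp: pm_space_def double_diff)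
qed

lemma pm_supp_closedin:
  assumes X: "pm_space X"
  shows "closedin (mtopology_of (pm_metric X)) (pm_supp X)"
  using pm_null_outside_supp(1)[OF X] pm_supp_subset[of X] by (simp add: closedin_def)

lemma pm_emeasure_Int_supp:
  assumes X: "pm_space X" and A: "A \<in> sets (pm_measure X)"
  shows "emeasure (pm_measure X) (A \<inter> pm_supp X) = emeasure (pm_measure X) A"
proof (rule emeasure_eq_AE)
  have "AE x in pm_measure X. x \<notin> pm_points X - pm_supp X"
    using pm_null_outside_supp[OF X] openin_pm_sets[OF X]
    by (intro AE_not_in) (auto simp: null_sets_def)
  then show "AE x in pm_measure X. x \<in> A \<inter> pm_supp X \<longleftrightarrow> x \<in> A"
    using A[THEN sets.sets_into_space] X by (auto simp: pm_space_def)
qed (use A pm_supp_sets[OF X] in auto)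

lemma pm_isometry_measurable:
  assumes X: "pm_space X" and m: "sets M = sigma_sets (mspace m) {U. openin (mtopology_of m) U}"
    and S: "S \<in> sets (pm_measure X)"
    and f: "f ` S \<subseteq> mspace m" "\<And>x y. x \<in> S \<Longrightarrow> y \<in> S \<Longrightarrow> mdist m (f x) (f y) = pm_dist X x y"
  shows "f \<in> measurable (restrict_space (pm_measure X) S) M"
proof -
  have sp: "space (restrict_space (pm_measure X) S) = S"
    using S sets.sets_into_space by (auto simp: space_restrict_space)
  have SX: "S \<subseteq> pm_points X" using S sets.sets_into_space X by (auto simp: pm_space_def)
  interpret A: Metric_space "pm_points X" "pm_dist X" by simp
  interpret B: Metric_space "mspace m" "mdist m" by simp
  show ?thesis
  proof (rule measurable_sigma_sets[OF m])
    show "{U. openin (mtopology_of m) U} \<subseteq> Pow (mspace m)" using openin_subset by fastforce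
    show "f \<in> space (restrict_space (pm_measure X) S) \<rightarrow> mspace m" using f(1) sp by auto
    fix U assume "U \<in> {U. openin (mtopology_of m) U}"
    then have U: "openin B.mtopology U" by (simp add: mtopology_of_def)
    define W where "W = \<Union>{A.mball x r | x r. x \<in> S \<and> f ` (A.mball x r \<inter> S) \<subseteq> U}"
    have "openin A.mtopology W" unfolding W_def by (rule openin_Union) auto
    then have W: "W \<in> sets (pm_measure X)" using openin_pm_sets[OF X] by (simp add: mtopology_of_def)
    have "f -` U \<inter> S = S \<inter> W"
    proof (intro equalityI subsetI)
      fix x assume x: "x \<in> f -` U \<inter> S"
      then obtain r where r: "r > 0" "B.mball (f x) r \<subseteq> U" using U B.openin_mtopology by auto
      have "f ` (A.mball x r \<inter> S) \<subseteq> U" using r(2) x f by (fastforce simp: B.in_mball)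
      then have "A.mball x r \<subseteq> W" unfolding W_def using x by blast
      moreover have "x \<in> A.mball x r" using x r SX by auto
      ultimately show "x \<in> S \<inter> W" using x by blast
    qed (auto simp: W_def)
    then show "f -` U \<inter> space (restrict_space (pm_measure X) S) \<in> sets (restrict_space (pm_measure X) S)"
      using W S unfolding sp by (auto simp: sets_restrict_space_iff)
  qed
qed

lemma pm_iso_iff:
  assumes X: "pm_space X" and Y: "pm_space Y"
  shows "pm_iso X Y \<longleftrightarrow> (\<exists>\<phi>.
     \<phi> ` pm_supp X = pm_supp Y \<and>
     (\<forall>x\<in>pm_supp X. \<forall>y\<in>pm_supp X. pm_dist Y (\<phi> x) (\<phi> y) = pm_dist X x y) \<and>
     (\<forall>B\<in>sets (pm_measure Y). \<phi> -` B \<inter> pm_supp X \<in> sets (pm_measure X) \<and>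
        emeasure (pm_measure X) (\<phi> -` B \<inter> pm_supp X) = emeasure (pm_measure Y) B))"
proof -
  have *: "distr (restrict_space (pm_measure X) (pm_supp X)) (pm_measure Y) \<phi> = pm_measure Y \<longleftrightarrow>
     (\<forall>B\<in>sets (pm_measure Y). \<phi> -` B \<inter> pm_supp X \<in> sets (pm_measure X) \<and>
        emeasure (pm_measure X) (\<phi> -` B \<inter> pm_supp X) = emeasure (pm_measure Y) B)"
    if "\<phi> ` pm_supp X = pm_supp Y"
       "\<forall>x\<in>pm_supp X. \<forall>y\<in>pm_supp X. pm_dist Y (\<phi> x) (\<phi> y) = pm_dist X x y" for \<phi>
  proof -
    let ?R = "restrict_space (pm_measure X) (pm_supp X)"
    have meas: "\<phi> \<in> measurable ?R (pm_measure Y)"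
      using that pm_supp_subset[of Y] Y
      by (intro pm_isometry_measurable[OF X _ pm_supp_sets[OF X], where m="pm_metric Y"]) (auto simp: pm_space_def)
    have sp: "space ?R = pm_supp X"
      using pm_supp_sets[OF X] sets.sets_into_space by (auto simp: space_restrict_space)
    have S: "\<phi> -` B \<inter> pm_supp X \<in> sets (pm_measure X)" if "B \<in> sets (pm_measure Y)" for B
      using measurable_sets[OF meas that] pm_supp_sets[OF X] unfolding sp
      by (auto simp: sets_restrict_space_iff)
    have E: "emeasure (distr ?R (pm_measure Y) \<phi>) B = emeasure (pm_measure X) (\<phi> -` B \<inter> pm_supp X)"
      if "B \<in> sets (pm_measure Y)" for B
      using that meas pm_supp_sets[OF X] by (simp add: emeasure_distr sp emeasure_restrict_space)
    show ?thesis using S E by (auto intro!: measure_eqI)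
  qed
  show ?thesis unfolding pm_iso_def using * by (rule_tac ex_cong1) blast
qed

lemma pm_iso_refl:
  assumes "pm_space X" shows "pm_iso X X"
  unfolding pm_iso_iff[OF assms assms]
  using pm_emeasure_Int_supp[OF assms] pm_supp_sets[OF assms]
  by (intro exI[of _ id]) (auto simp: vimage_def)

lemma pm_iso_sym:
  assumes X: "pm_space X" and Y: "pm_space Y" and "pm_iso X Y" shows "pm_iso Y X"
proof -
  obtain \<phi> where f: "\<phi> ` pm_supp X = pm_supp Y"
     "\<And>x y. x\<in>pm_supp X \<Longrightarrow> y\<in>pm_supp X \<Longrightarrow> pm_dist Y (\<phi> x) (\<phi> y) = pm_dist X x y"
     "\<And>B. B\<in>sets (pm_measure Y) \<Longrightarrow> emeasure (pm_measure X) (\<phi> -` B \<inter> pm_supp X) = emeasure (pm_measure Y) B"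
    using assms(3) unfolding pm_iso_iff[OF X Y] by blast
  have inj: "inj_on \<phi> (pm_supp X)"
  proof (rule inj_onI)
    fix x y assume h: "x \<in> pm_supp X" "y \<in> pm_supp X" "\<phi> x = \<phi> y"
    have "\<phi> y \<in> pm_points Y" using h(2) f(1) pm_supp_subset[of Y] by blast
    then have "pm_dist Y (\<phi> x) (\<phi> y) = 0" using h(3) by simp
    then have "pm_dist X x y = 0" using f(2)[OF h(1,2)] by simp
    moreover have "x \<in> pm_points X" "y \<in> pm_points X" using h pm_supp_subset[of X] by blast+
    ultimately show "x = y" by simp
  qed
  define g where "g = inv_into (pm_supp X) \<phi>"
  have g: "g ` pm_supp Y = pm_supp X" unfolding g_def f(1)[symmetric] using inj by (simp add: inv_into_image_cancel)
  have gf: "g (\<phi> x) = x" if "x \<in> pm_supp X" for x using inj that by (simp add: g_def)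
  have fg: "\<phi> (g y) = y" "g y \<in> pm_supp X" if "y \<in> pm_supp Y" for y
    using that f_inv_into_f[of y \<phi> "pm_supp X"] inv_into_into[of y \<phi> "pm_supp X"]
    unfolding g_def f(1) by blast+
  have iso: "pm_dist X (g x) (g y) = pm_dist Y x y" if "x \<in> pm_supp Y" "y \<in> pm_supp Y" for x y
    using f(2)[OF fg(2)[OF that(1)] fg(2)[OF that(2)]] fg(1)[OF that(1)] fg(1)[OF that(2)] by simp
  have meas: "g \<in> measurable (restrict_space (pm_measure Y) (pm_supp Y)) (pm_measure X)"
    using g iso pm_supp_subset[of X] X
    by (intro pm_isometry_measurable[OF Y _ pm_supp_sets[OF Y], where m="pm_metric X"]) (auto simp: pm_space_def)
  have sp: "space (restrict_space (pm_measure Y) (pm_supp Y)) = pm_supp Y"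
    using pm_supp_sets[OF Y] sets.sets_into_space by (auto simp: space_restrict_space)
  have S: "g -` B \<inter> pm_supp Y \<in> sets (pm_measure Y)" if "B \<in> sets (pm_measure X)" for B
    using measurable_sets[OF meas that] pm_supp_sets[OF Y] unfolding sp
    by (auto simp: sets_restrict_space_iff)
  have "emeasure (pm_measure Y) (g -` B \<inter> pm_supp Y) = emeasure (pm_measure X) B"
    if B: "B \<in> sets (pm_measure X)" for B
  proof -
    have "\<phi> -` (g -` B \<inter> pm_supp Y) \<inter> pm_supp X = B \<inter> pm_supp X"
    proof (intro equalityI subsetI)
      fix x assume "x \<in> B \<inter> pm_supp X"
      then show "x \<in> \<phi> -` (g -` B \<inter> pm_supp Y) \<inter> pm_supp X" using gf[of x] f(1) by auto
    next
      fix x assume "x \<in> \<phi> -` (g -` B \<inter> pm_supp Y) \<inter> pm_supp X"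
      then show "x \<in> B \<inter> pm_supp X" using gf[of x] by auto
    qed
    then show ?thesis using f(3)[OF S[OF B]] pm_emeasure_Int_supp[OF X B] by simp
  qed
  then show ?thesis unfolding pm_iso_iff[OF Y X] using g iso S
    by (intro exI[of _ g] conjI ballI) simp_all
qed

lemma pm_iso_trans:
  assumes X: "pm_space X" and Y: "pm_space Y" and Z: "pm_space Z"
    and "pm_iso X Y" "pm_iso Y Z" shows "pm_iso X Z"
proof -
  obtain \<phi> where f: "\<phi> ` pm_supp X = pm_supp Y"
     "\<And>x y. x\<in>pm_supp X \<Longrightarrow> y\<in>pm_supp X \<Longrightarrow> pm_dist Y (\<phi> x) (\<phi> y) = pm_dist X x y"
     "\<And>B. B\<in>sets (pm_measure Y) \<Longrightarrow> \<phi> -` B \<inter> pm_supp X \<in> sets (pm_measure X)"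
     "\<And>B. B\<in>sets (pm_measure Y) \<Longrightarrow> emeasure (pm_measure X) (\<phi> -` B \<inter> pm_supp X) = emeasure (pm_measure Y) B"
    using assms(4) unfolding pm_iso_iff[OF X Y] by blast
  obtain \<psi> where g: "\<psi> ` pm_supp Y = pm_supp Z"
     "\<And>x y. x\<in>pm_supp Y \<Longrightarrow> y\<in>pm_supp Y \<Longrightarrow> pm_dist Z (\<psi> x) (\<psi> y) = pm_dist Y x y"
     "\<And>B. B\<in>sets (pm_measure Z) \<Longrightarrow> \<psi> -` B \<inter> pm_supp Y \<in> sets (pm_measure Y)"
     "\<And>B. B\<in>sets (pm_measure Z) \<Longrightarrow> emeasure (pm_measure Y) (\<psi> -` B \<inter> pm_supp Y) = emeasure (pm_measure Z) B"
    using assms(5) unfolding pm_iso_iff[OF Y Z] by blast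
  have eq: "(\<psi> \<circ> \<phi>) -` B \<inter> pm_supp X = \<phi> -` (\<psi> -` B \<inter> pm_supp Y) \<inter> pm_supp X" for B
    using f(1) by auto
  have mem: "\<phi> x \<in> pm_supp Y" if "x \<in> pm_supp X" for x using f(1) that by blast
  show ?thesis unfolding pm_iso_iff[OF X Z]
  proof (intro exI[of _ "\<psi> \<circ> \<phi>"] conjI ballI)
    show "(\<psi> \<circ> \<phi>) ` pm_supp X = pm_supp Z" using f(1) g(1) by (metis image_comp)
    show "pm_dist Z ((\<psi> \<circ> \<phi>) x) ((\<psi> \<circ> \<phi>) y) = pm_dist X x y"
      if "x \<in> pm_supp X" "y \<in> pm_supp X" for x y
      using that by (simp add: f(2) g(2) mem)
  qed (simp_all only: eq f(3,4) g(3,4))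
qed

theorem equiv_pm_iso_rel: "equiv {X. pm_space X} pm_iso_rel"
  unfolding pm_iso_rel_def
  by (intro equivI refl_onI symI transI)
     (auto intro: pm_iso_refl pm_iso_sym pm_iso_trans)

theorem pm_space_representable:
  fixes X :: "'a pm"
  assumes X: "pm_space X"
  shows "\<exists>Y :: real_pm. pm_space Y \<and> pm_supp Y = pm_points Y \<and> pm_iso X Y"
proof -
  let ?S = "pm_supp X" and ?T = "mtopology_of (pm_metric X)"
  interpret A: Metric_space "pm_points X" "pm_dist X" by simp
  interpret P: prob_space "pm_measure X" using X by (simp add: pm_space_def)
  have top: "?T = A.mtopology" by (simp add: mtopology_of_def)
  have ne: "pm_points X \<noteq> {}" using X P.not_empty by (simp add: pm_space_def)
  have dense: "\<exists>s :: nat \<Rightarrow> 'a. range s \<subseteq> pm_points X \<and> ?T closure_of (range s) = pm_points X"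
  proof -
    obtain C where C: "countable C" "C \<subseteq> pm_points X" "?T closure_of C = pm_points X"
      using X unfolding pm_space_def separable_space_def by auto
    then have "C \<noteq> {}" using ne by auto
    then show ?thesis using C by (intro exI[of _ "from_nat_into C"]) (auto simp: range_from_nat_into)
  qed
  then obtain s :: "nat \<Rightarrow> 'a" where s: "range s \<subseteq> pm_points X" "?T closure_of (range s) = pm_points X"
    by blast
  define e :: "'a \<Rightarrow> nat \<Rightarrow> real" where "e x n = pm_dist X x (s n)" for x n
  have inj: "inj_on e ?S"
  proof (rule inj_onI, rule ccontr)
    fix x y assume h: "x \<in> ?S" "y \<in> ?S" "e x = e y" "x \<noteq> y"
    then have xy: "x \<in> pm_points X" "y \<in> pm_points X" using pm_supp_subset[of X] by auto
    then have d: "pm_dist X x y > 0" using h(4) by auto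
    have "x \<in> A.mtopology closure_of (range s)" using s(2) xy top by simp
    then obtain n where n: "s n \<in> A.mball x (pm_dist X x y / 2)"
      using A.metric_closure_of[of "range s"] d by (auto dest!: spec[of _ "pm_dist X x y / 2"])
    have "pm_dist X x (s n) = pm_dist X y (s n)" using fun_cong[OF h(3), of n] by (simp add: e_def)
    moreover have "pm_dist X x y \<le> pm_dist X x (s n) + pm_dist X (s n) y"
      using xy s(1) by (intro A.triangle) auto
    ultimately show False using n A.commute[of "s n" y] by auto
  qed
  define g where "g = inv_into ?S e"
  have ge: "g (e x) = x" if "x \<in> ?S" for x using inj that by (simp add: g_def)
  define D where "D u v = pm_dist X (g u) (g v)" for u v
  interpret B: Metric_space "e ` ?S" D
  proof
    show "0 \<le> D u v" "D u v = D v u" for u v by (auto simp: D_def A.commute)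
    show "D u v = 0 \<longleftrightarrow> u = v" if uv: "u \<in> e ` ?S" "v \<in> e ` ?S" for u v
    proof -
      obtain x y where xy: "x \<in> ?S" "y \<in> ?S" "u = e x" "v = e y" using uv by blast
      then have "x \<in> pm_points X" "y \<in> pm_points X" using pm_supp_subset[of X] by blast+
      then show ?thesis using A.zero[of x y] xy inj_on_eq_iff[OF inj xy(1,2)] ge[OF xy(1)] ge[OF xy(2)]
        by (simp only: D_def)
    qed
    show "D u w \<le> D u v + D v w" if uvw: "u \<in> e ` ?S" "v \<in> e ` ?S" "w \<in> e ` ?S" for u v w
    proof -
      have "g t \<in> pm_points X" if "t \<in> e ` ?S" for t
        using that ge pm_supp_subset[of X] by auto
      then show ?thesis unfolding D_def using uvw by (intro A.triangle) blast+
    qed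
  qed
  define m where "m = metric (e ` ?S, D)"
  have m: "mspace m = e ` ?S" "mdist m = D" "mtopology_of m = B.mtopology" by (auto simp: m_def)
  define G where "G = {U. openin (mtopology_of m) U}"
  have G: "G \<subseteq> Pow (mspace m)" using openin_subset[of "mtopology_of m"] by (auto simp: G_def)
  let ?R = "restrict_space (pm_measure X) ?S"
  define N where "N = sigma (mspace m) G"
  have N: "sets N = sigma_sets (mspace m) G" "space N = mspace m" using G by (auto simp: N_def)
  define Y where "Y = (m, distr ?R N e)"
  have isoD: "D (e x) (e y) = pm_dist X x y" if "x \<in> ?S" "y \<in> ?S" for x y
    using that by (simp add: D_def ge)
  have meas: "e \<in> measurable ?R N"
    using isoD N(1) unfolding G_def
    by (intro pm_isometry_measurable[OF X _ pm_supp_sets[OF X], where m=m]) (auto simp: m)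
  have sp: "space ?R = ?S"
    using pm_supp_sets[OF X] sets.sets_into_space by (auto simp: space_restrict_space)
  have eS: "e -` V \<inter> ?S \<in> sets (pm_measure X)" if "V \<in> sets N" for V
    using measurable_sets[OF meas that] pm_supp_sets[OF X] unfolding sp
    by (auto simp: sets_restrict_space_iff)
  have E: "emeasure (pm_measure Y) V = emeasure (pm_measure X) (e -` V \<inter> ?S)" if "V \<in> sets N" for V
    using that meas pm_supp_sets[OF X] by (simp add: Y_def emeasure_distr sp emeasure_restrict_space)
  have S1: "emeasure (pm_measure X) ?S = 1"
    using pm_emeasure_Int_supp[OF X sets.top] P.emeasure_space_1 X pm_supp_subset[of X]
    by (simp add: pm_space_def Int_absorb1)
  have hom: "homeomorphic_map (subtopology ?T ?S) B.mtopology e"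
  proof -
    interpret SM: Submetric "pm_points X" "pm_dist X" ?S
      by unfold_locales (rule pm_supp_subset)
    show ?thesis
    proof -
      have c1: "continuous_map SM.sub.mtopology B.mtopology e"
        unfolding Metric_space.metric_continuous_map[OF SM.sub.Metric_space_axioms B.Metric_space_axioms]
        using isoD by auto
      have c2: "continuous_map B.mtopology SM.sub.mtopology g"
        unfolding Metric_space.metric_continuous_map[OF B.Metric_space_axioms SM.sub.Metric_space_axioms]
        using isoD ge by (auto simp: D_def)
      have "homeomorphic_maps SM.sub.mtopology B.mtopology e g"
        unfolding homeomorphic_maps_def using c1 c2 ge by auto
      then have "homeomorphic_map SM.sub.mtopology B.mtopology e"
        unfolding homeomorphic_map_maps by blast
      then show ?thesis using SM.mtopology_submetric top by simp
    qed
  qed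
  have pmY: "pm_space Y"
    unfolding pm_space_def
  proof (intro conjI)
    show "space (pm_measure Y) = pm_points Y" by (simp add: Y_def N(2))
    show "sets (pm_measure Y) = sigma_sets (pm_points Y) {U. openin (mtopology_of (pm_metric Y)) U}"
      by (simp add: Y_def N(1) G_def)
    show "prob_space (pm_measure Y)"
    proof
      have "e -` mspace m \<inter> ?S = ?S" by (auto simp: m)
      then show "emeasure (pm_measure Y) (space (pm_measure Y)) = 1"
        using E[OF sets.top] S1 N(2) by (simp add: Y_def)
    qed
    have "second_countable (subtopology ?T ?S)"
      using X by (intro second_countable_subtopology pm_second_countable) (simp add: pm_space_def)
    then have "separable_space (subtopology ?T ?S)" by (rule second_countable_imp_separable_space)
    then have "separable_space B.mtopology"
      using homeomorphic_separable_space hom homeomorphic_map_imp_homeomorphic_space by blast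
    then show "separable_space (mtopology_of (pm_metric Y))" by (simp add: Y_def m)
    have "B.mcomplete"
      unfolding B.mcomplete_def
    proof (intro allI impI)
      fix \<sigma> assume c: "B.MCauchy \<sigma>"
      then have r: "\<exists>x\<in>?S. \<sigma> n = e x" for n unfolding B.MCauchy_def by blast
      have gS: "g (\<sigma> n) \<in> ?S" for n using r[of n] ge by auto
      have "A.MCauchy (g \<circ> \<sigma>)"
        using c gS pm_supp_subset[of X] unfolding A.MCauchy_def B.MCauchy_def by (auto simp: D_def)
      moreover have "A.mcomplete" using X by (simp add: pm_space_def mcomplete_of_def)
      ultimately obtain x where x: "limitin A.mtopology (g \<circ> \<sigma>) x sequentially"
        unfolding A.mcomplete_def by blast
      have xS: "x \<in> ?S"
        using limitin_closedin[OF x, of ?S] pm_supp_closedin[OF X] gS top by (auto simp: )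
      have "limitin B.mtopology \<sigma> (e x) sequentially"
        unfolding B.limitin_metric
      proof (intro conjI allI impI)
        show "e x \<in> e ` ?S" using xS by blast
        fix \<epsilon> :: real assume "\<epsilon> > 0"
        then have "\<forall>\<^sub>F n in sequentially. (g \<circ> \<sigma>) n \<in> pm_points X \<and> pm_dist X ((g \<circ> \<sigma>) n) x < \<epsilon>"
          using x unfolding A.limitin_metric by blast
        then show "\<forall>\<^sub>F n in sequentially. \<sigma> n \<in> e ` ?S \<and> D (\<sigma> n) (e x) < \<epsilon>"
        proof (rule eventually_mono)
          fix n assume "(g \<circ> \<sigma>) n \<in> pm_points X \<and> pm_dist X ((g \<circ> \<sigma>) n) x < \<epsilon>"
          then show "\<sigma> n \<in> e ` ?S \<and> D (\<sigma> n) (e x) < \<epsilon>"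
            using r[of n] xS by (auto simp: D_def ge)
        qed
      qed
      then show "\<exists>x. limitin B.mtopology \<sigma> x sequentially" by blast
    qed
    then show "mcomplete_of (pm_metric Y)" by (simp add: Y_def m_def)
  qed
  have suppY: "pm_supp Y = e ` ?S"
  proof
    show "pm_supp Y \<subseteq> e ` ?S" using pm_supp_subset[of Y] by (simp add: Y_def m)
    show "e ` ?S \<subseteq> pm_supp Y"
    proof clarify
      fix x assume x: "x \<in> ?S"
      show "e x \<in> pm_supp Y"
        unfolding pm_supp_def
      proof (intro CollectI conjI allI impI)
        show "e x \<in> pm_points Y" using x by (simp add: Y_def m)
        fix U assume U: "openin (mtopology_of (pm_metric Y)) U \<and> e x \<in> U"
        then have UB: "openin B.mtopology U" by (simp add: Y_def m)
        have UN: "U \<in> sets N" using U openin_pm_sets[OF pmY] by (simp add: Y_def)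
        have "openin (subtopology ?T ?S) {z \<in> topspace (subtopology ?T ?S). e z \<in> U}"
          using hom UB homeomorphic_imp_continuous_map openin_continuous_map_preimage by blast
        moreover have "{z \<in> topspace (subtopology ?T ?S). e z \<in> U} = e -` U \<inter> ?S"
          using pm_supp_subset[of X] by auto
        ultimately have "openin (subtopology ?T ?S) (e -` U \<inter> ?S)" by (simp only:)
        then obtain V where V: "openin ?T V" "e -` U \<inter> ?S = V \<inter> ?S"
          unfolding openin_subtopology by blast
        have "x \<in> V" using x V U by blast
        then have "emeasure (pm_measure X) V > 0" using x V(1) by (auto simp: pm_supp_def)
        then show "emeasure (pm_measure Y) U > 0"
          using E[OF UN] pm_emeasure_Int_supp[OF X openin_pm_sets[OF X V(1)]] unfolding V(2) by simp
      qed
    qed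
  qed
  have "pm_iso X Y"
    unfolding pm_iso_iff[OF X pmY]
  proof (intro exI[of _ e] conjI ballI)
    show "e ` ?S = pm_supp Y" using suppY by simp
    show "pm_dist Y (e x) (e y) = pm_dist X x y" if "x \<in> ?S" "y \<in> ?S" for x y
      using isoD[OF that] by (simp add: Y_def m)
    fix V assume "V \<in> sets (pm_measure Y)"
    then have V: "V \<in> sets N" by (simp add: Y_def)
    show "e -` V \<inter> ?S \<in> sets (pm_measure X)" by (rule eS[OF V])
    show "emeasure (pm_measure X) (e -` V \<inter> ?S) = emeasure (pm_measure Y) V"
      by (rule E[OF V, symmetric])
  qed
  moreover have "pm_points Y = e ` ?S" by (simp add: Y_def m)
  ultimately show ?thesis using pmY suppY by metis
qed

lemma pm_rep:
  assumes "\<X> \<in> pm_classes"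
  shows "pm_rep \<X> \<in> \<X>" "pm_space (pm_rep \<X>)" "pm_supp (pm_rep \<X>) = pm_points (pm_rep \<X>)"
proof -
  obtain X where X: "pm_space X" "\<X> = pm_iso_rel `` {X}"
    using assms unfolding pm_classes_def quotient_def by blast
  have "\<exists>Y. Y \<in> \<X> \<and> pm_supp Y = pm_points Y"
    using pm_space_representable[OF X(1)] X by (auto simp: pm_iso_rel_def)
  then have "pm_rep \<X> \<in> \<X> \<and> pm_supp (pm_rep \<X>) = pm_points (pm_rep \<X>)"
    unfolding pm_rep_def by (rule someI_ex)
  then show "pm_rep \<X> \<in> \<X>" "pm_space (pm_rep \<X>)" "pm_supp (pm_rep \<X>) = pm_points (pm_rep \<X>)"
    using X by (auto simp: pm_iso_rel_def)
qed

lemma pm_class_in_pm_classes: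
  assumes X: "pm_space X"
  shows "pm_class X \<in> pm_classes"
proof -
  obtain Y :: real_pm where Y: "pm_space Y" "pm_iso X Y" using pm_space_representable[OF X] by blast
  have "pm_class X = pm_iso_rel `` {Y}"
  proof (intro equalityI subsetI)
    fix Z assume "Z \<in> pm_class X"
    then have Z: "pm_space Z" "pm_iso X Z" by (auto simp: pm_class_def)
    have "pm_iso Y Z" by (rule pm_iso_trans[OF Y(1) X Z(1) pm_iso_sym[OF X Y] Z(2)])
    then show "Z \<in> pm_iso_rel `` {Y}" using Y(1) Z(1) by (simp add: pm_iso_rel_def)
  next
    fix Z assume "Z \<in> pm_iso_rel `` {Y}"
    then have Z: "pm_space Z" "pm_iso Y Z" by (auto simp: pm_iso_rel_def)
    have "pm_iso X Z" by (rule pm_iso_trans[OF X Y(1) Z(1) Y(2) Z(2)])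
    then show "Z \<in> pm_class X" using Z(1) by (simp add: pm_class_def)
  qed
  then show ?thesis using Y(1) quotientI[of Y "{X. pm_space X}" pm_iso_rel] by (simp add: pm_classes_def)
qed

lemma istopology_box:
  "istopology (\<lambda>U. U \<subseteq> pm_classes \<and>
     (\<forall>\<X>\<in>U. \<exists>r>0. {\<Y> \<in> pm_classes. class_box_dist \<X> \<Y> < ennreal r} \<subseteq> U))"
  unfolding istopology_def
proof (intro conjI allI impI)
  fix S T
  assume S: "S \<subseteq> pm_classes \<and> (\<forall>\<X>\<in>S. \<exists>r>0. {\<Y> \<in> pm_classes. class_box_dist \<X> \<Y> < ennreal r} \<subseteq> S)"
    and T: "T \<subseteq> pm_classes \<and> (\<forall>\<X>\<in>T. \<exists>r>0. {\<Y> \<in> pm_classes. class_box_dist \<X> \<Y> < ennreal r} \<subseteq> T)"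
  show "S \<inter> T \<subseteq> pm_classes" using S by blast
  show "\<forall>\<X>\<in>S \<inter> T. \<exists>r>0. {\<Y> \<in> pm_classes. class_box_dist \<X> \<Y> < ennreal r} \<subseteq> S \<inter> T"
  proof
    fix \<X> assume "\<X> \<in> S \<inter> T"
    then obtain r1 r2 where r: "r1 > 0" "{\<Y> \<in> pm_classes. class_box_dist \<X> \<Y> < ennreal r1} \<subseteq> S"
      "r2 > 0" "{\<Y> \<in> pm_classes. class_box_dist \<X> \<Y> < ennreal r2} \<subseteq> T" using S T by blast
    have "ennreal (min r1 r2) \<le> ennreal r1" "ennreal (min r1 r2) \<le> ennreal r2"
      by (auto intro: ennreal_leI)
    then have "{\<Y> \<in> pm_classes. class_box_dist \<X> \<Y> < ennreal (min r1 r2)} \<subseteq> S \<inter> T"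
      using r(2,4) less_le_trans by blast
    then show "\<exists>r>0. {\<Y> \<in> pm_classes. class_box_dist \<X> \<Y> < ennreal r} \<subseteq> S \<inter> T"
      using r(1,3) by (intro exI[of _ "min r1 r2"]) simp
  qed
next
  fix K :: "real_pm set set set"
  assume K: "\<forall>U\<in>K. U \<subseteq> pm_classes \<and>
     (\<forall>\<X>\<in>U. \<exists>r>0. {\<Y> \<in> pm_classes. class_box_dist \<X> \<Y> < ennreal r} \<subseteq> U)"
  then show "\<Union>K \<subseteq> pm_classes" by blast
  show "\<forall>\<X>\<in>\<Union>K. \<exists>r>0. {\<Y> \<in> pm_classes. class_box_dist \<X> \<Y> < ennreal r} \<subseteq> \<Union>K"
  proof
    fix \<X> assume "\<X> \<in> \<Union>K"
    then obtain U where U: "U \<in> K" "\<X> \<in> U" by blast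
    then obtain r where "r > 0" "{\<Y> \<in> pm_classes. class_box_dist \<X> \<Y> < ennreal r} \<subseteq> U"
      using K by blast
    then show "\<exists>r>0. {\<Y> \<in> pm_classes. class_box_dist \<X> \<Y> < ennreal r} \<subseteq> \<Union>K"
      using U(1) by blast
  qed
qed

lemma openin_box_topology:
  "openin box_topology U \<longleftrightarrow> U \<subseteq> pm_classes \<and>
     (\<forall>\<X>\<in>U. \<exists>r>0. {\<Y> \<in> pm_classes. class_box_dist \<X> \<Y> < ennreal r} \<subseteq> U)"
  unfolding box_topology_def using istopology_box by (simp add: topology_inverse')

lemma topspace_box_topology: "topspace box_topology = pm_classes"
proof
  show "topspace box_topology \<subseteq> pm_classes"
    using openin_box_topology[of "topspace box_topology"] by auto
  have "openin box_topology pm_classes"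
    unfolding openin_box_topology by (auto intro: exI[of _ 1])
  then show "pm_classes \<subseteq> topspace box_topology" by (rule openin_subset)
qed

end

theory Submission
  imports Defs
begin

text \<open>Pulling back along a 1-Lipschitz map does not increase the asymptotic Lipschitz constant, which
  gives monotonicity and, together with a scaling computation, 1-homogeneity. For lower
  semicontinuity let \<open>f\<close> be bounded and Lipschitz on \<open>X\<close> and let \<open>Y\<close> be box-close to \<open>X\<close> through
  parameters \<open>a\<close>, \<open>b\<close> and a set \<open>I\<close>. The function \<open>f \<circ> a\<close> on \<open>b ` I\<close> has an extension \<open>F\<close> to \<open>Y\<close> that is
  accurate up to a small error, globally Lipschitz with a constant independent of the distance,
  and whose asymptotic Lipschitz constant at \<open>b t\<close> is bounded by the Lipschitz constant of \<open>f\<close> on a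
  small ball around \<open>a t\<close>. Integrating over \<open>[0, 1]\<close> transfers the Poincare inequality of \<open>Y\<close> for
  \<open>F\<close> to one for \<open>f\<close> in which \<open>lip_a\<close> is replaced by Lipschitz constants on small balls. Letting first
  the box distance and then the radius tend to 0 gives the inequality for \<open>f\<close>.\<close>

section \<open>Asymptotic Lipschitz constants\<close>

lemma lip_const_le:
  assumes "0 \<le> L" "\<And>x y. x \<in> S \<Longrightarrow> y \<in> S \<Longrightarrow> \<bar>f x - f y\<bar> \<le> L * mdist m x y"
  shows "lip_const m S f \<le> L"
  unfolding lip_const_def using assms by (intro cInf_lower bdd_belowI[of _ 0]) auto

text \<open>An infimum of nonnegative reals is nonnegative only if the set is nonempty; the
  Lipschitz bound \<open>L\<close> provides a member.\<close>

lemma lip_const_nonneg: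
  assumes "0 \<le> L" "\<And>x y. x \<in> S \<Longrightarrow> y \<in> S \<Longrightarrow> \<bar>f x - f y\<bar> \<le> L * mdist m x y"
  shows "0 \<le> lip_const m S f"
  unfolding lip_const_def using assms by (intro cInf_greatest) auto

text \<open>The infimum is attained: every admissible constant dominates the difference quotient of
  \<open>x\<close> and \<open>y\<close>, hence so does their infimum. Pairs at distance 0 need
  \<open>L\<close> itself.\<close>

lemma lip_const_bound:
  assumes L: "0 \<le> L" "\<And>x y. x \<in> S \<Longrightarrow> y \<in> S \<Longrightarrow> \<bar>f x - f y\<bar> \<le> L * mdist m x y"
    and xy: "x \<in> S" "y \<in> S"
  shows "\<bar>f x - f y\<bar> \<le> lip_const m S f * mdist m x y"
proof (cases "mdist m x y = 0")
  case True
  then show ?thesis using L(2)[OF xy] by simp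
next
  case False
  then have d: "mdist m x y > 0" using mdist_nonneg[of m x y] by linarith
  have "\<bar>f x - f y\<bar> / mdist m x y \<le> lip_const m S f"
    unfolding lip_const_def
    by (rule cInf_greatest) (use L xy d in \<open>auto simp: divide_simps\<close>)
  then show ?thesis using d by (simp add: divide_simps)
qed

lemma lip_const_mono:
  assumes "S \<subseteq> T" "0 \<le> L" "\<And>x y. x \<in> T \<Longrightarrow> y \<in> T \<Longrightarrow> \<bar>f x - f y\<bar> \<le> L * mdist m x y"
  shows "lip_const m S f \<le> lip_const m T f"
  using assms by (intro lip_const_le lip_const_nonneg[where L=L] lip_const_bound[where L=L]) blast+

lemma bounded_lipschitzE:
  assumes "bounded_lipschitz m f"
  obtains L M where "L > 0" "M > 0"
    "\<And>x y. x \<in> mspace m \<Longrightarrow> y \<in> mspace m \<Longrightarrow> \<bar>f x - f y\<bar> \<le> L * mdist m x y"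
    "\<And>x. x \<in> mspace m \<Longrightarrow> \<bar>f x\<bar> \<le> M"
proof -
  obtain L where "L > 0" "\<And>x y. x \<in> mspace m \<Longrightarrow> y \<in> mspace m \<Longrightarrow> \<bar>f x - f y\<bar> \<le> L * mdist m x y"
    using assms unfolding bounded_lipschitz_def Lipschitz_continuous_map_pos
    by (auto simp: dist_real_def)
  moreover obtain M where "M > 0" "\<And>x. x \<in> mspace m \<Longrightarrow> \<bar>f x\<bar> \<le> M"
    using assms unfolding bounded_lipschitz_def bounded_pos by auto
  ultimately show ?thesis using that by blast
qed

lemma bounded_lipschitzI:
  assumes "\<And>x y. x \<in> mspace m \<Longrightarrow> y \<in> mspace m \<Longrightarrow> \<bar>f x - f y\<bar> \<le> L * mdist m x y"
    "\<And>x. x \<in> mspace m \<Longrightarrow> \<bar>f x\<bar> \<le> M"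
  shows "bounded_lipschitz m f"
  using assms unfolding bounded_lipschitz_def Lipschitz_continuous_map_def bounded_iff
  by (auto simp: dist_real_def)

text \<open>\<open>Lim\<close> carries information only if the limit exists. Here it does: the
  constants are nonnegative and increase with the radius, so they converge to their infimum over
  positive radii.\<close>

lemma lip_const_mcball_tendsto:
  assumes L: "0 \<le> L" "\<And>x y. x \<in> mspace m \<Longrightarrow> y \<in> mspace m \<Longrightarrow> \<bar>f x - f y\<bar> \<le> L * mdist m x y"
  shows "((\<lambda>r. lip_const m (mcball_of m x r) f) \<longlongrightarrow> lip_a m f x) (at_right 0)"
proof -
  interpret Metric_space "mspace m" "mdist m" by simp
  let ?h = "\<lambda>r. lip_const m (mcball x r) f"
  have sub: "mcball x r \<subseteq> mspace m" for r by auto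
  have nn: "0 \<le> ?h r" for r using L by (intro lip_const_nonneg[where L=L]) auto
  have mono: "?h r \<le> ?h s" if "r \<le> s" for r s
    using that L by (intro lip_const_mono[where L=L]) auto
  have "(?h \<longlongrightarrow> (INF r\<in>{0<..}. ?h r)) (at_right 0)"
  proof (rule order_tendstoI)
    fix c assume "c < (INF r\<in>{0<..}. ?h r)"
    moreover have "(INF r\<in>{0<..}. ?h r) \<le> ?h r" if "r > 0" for r
      using that nn by (intro cINF_lower bdd_belowI[of _ 0]) auto
    ultimately have "c < ?h r" if "r > 0" for r using that less_le_trans by blast
    then show "\<forall>\<^sub>F r in at_right 0. c < ?h r"
      unfolding eventually_at_right_field by (intro exI[of _ 1]) simp
  next
    fix c assume c: "(INF r\<in>{0<..}. ?h r) < c"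
    obtain s where "s > 0" "?h s < c"
      using cInf_lessD[OF _ c] by auto
    then have "?h r < c" if "r < s" for r using mono[of r s] that by simp
    then show "\<forall>\<^sub>F r in at_right 0. ?h r < c"
      unfolding eventually_at_right_field using \<open>s > 0\<close> by blast
  qed
  then have t: "((\<lambda>r. lip_const m (mcball_of m x r) f) \<longlongrightarrow> (INF r\<in>{0<..}. ?h r)) (at_right 0)"
    by (simp add: mcball_of_def)
  then show ?thesis unfolding lip_a_def using tendsto_Lim[OF _ t] by simp
qed

lemma lip_a_le:
  assumes f: "0 \<le> K" "\<And>x y. x \<in> mspace m \<Longrightarrow> y \<in> mspace m \<Longrightarrow> \<bar>f x - f y\<bar> \<le> K * mdist m x y"
    and r: "0 < r" and L: "0 \<le> L"
    "\<And>y z. y \<in> mball_of m x r \<Longrightarrow> z \<in> mball_of m x r \<Longrightarrow> \<bar>f y - f z\<bar> \<le> L * mdist m y z"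
  shows "lip_a m f x \<le> L"
proof (rule tendsto_upperbound[OF lip_const_mcball_tendsto[OF f]])
  interpret Metric_space "mspace m" "mdist m" by simp
  have "lip_const m (mcball_of m x s) f \<le> L" if "s < r" for s
    using that L by (intro lip_const_le) (auto simp: mball_of_def mcball_of_def)
  then show "\<forall>\<^sub>F s in at_right 0. lip_const m (mcball_of m x s) f \<le> L"
    using r by (auto simp: eventually_at_right_field)
qed auto

text \<open>Together with \<open>lip_a_le\<close> this reduces comparisons of \<open>lip_a\<close>
  to Lipschitz estimates on one open ball, without handling the limit. The closed ball of radius
  \<open>b/2\<close> has constant below \<open>L\<close> and contains the open one.\<close>

lemma lip_a_ge:
  assumes f: "0 \<le> K" "\<And>x y. x \<in> mspace m \<Longrightarrow> y \<in> mspace m \<Longrightarrow> \<bar>f x - f y\<bar> \<le> K * mdist m x y"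
    and L: "lip_a m f x < L"
  obtains r where "r > 0"
    "\<And>y z. y \<in> mball_of m x r \<Longrightarrow> z \<in> mball_of m x r \<Longrightarrow> \<bar>f y - f z\<bar> \<le> L * mdist m y z"
proof -
  interpret Metric_space "mspace m" "mdist m" by simp
  have "\<forall>\<^sub>F s in at_right 0. lip_const m (mcball_of m x s) f < L"
    by (rule order_tendstoD(2)[OF lip_const_mcball_tendsto[OF f] L])
  then obtain b where b: "b > 0" "\<And>s. 0 < s \<Longrightarrow> s < b \<Longrightarrow> lip_const m (mcball_of m x s) f < L"
    unfolding eventually_at_right_field by auto
  have h: "lip_const m (mcball_of m x (b/2)) f < L" using b by simp
  have "\<bar>f y - f z\<bar> \<le> L * mdist m y z"
    if "y \<in> mball_of m x (b/2)" "z \<in> mball_of m x (b/2)" for y z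
  proof -
    have "\<bar>f y - f z\<bar> \<le> lip_const m (mcball_of m x (b/2)) f * mdist m y z"
      using that f by (intro lip_const_bound[where L=K]) (auto simp: mball_of_def mcball_of_def)
    also have "\<dots> \<le> L * mdist m y z" using h by (intro mult_right_mono) auto
    finally show ?thesis .
  qed
  then show ?thesis using that[of "b/2"] b(1) by auto
qed

lemma lip_a_nonneg:
  assumes f: "0 \<le> K" "\<And>x y. x \<in> mspace m \<Longrightarrow> y \<in> mspace m \<Longrightarrow> \<bar>f x - f y\<bar> \<le> K * mdist m x y"
  shows "0 \<le> lip_a m f x"
proof (rule tendsto_lowerbound[OF lip_const_mcball_tendsto[OF f]])
  interpret Metric_space "mspace m" "mdist m" by simp
  have "0 \<le> lip_const m (mcball_of m x s) f" for s
    using f by (intro lip_const_nonneg[where L=K]) (auto simp: mcball_of_def)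
  then show "\<forall>\<^sub>F s in at_right 0. 0 \<le> lip_const m (mcball_of m x s) f" by simp
qed auto

section \<open>Lipschitz constants on open balls: convergence, measurability and
  integrability\<close>

lemma lip_const_mball_bounds:
  assumes "0 \<le> L" "\<And>x y. x \<in> mspace m \<Longrightarrow> y \<in> mspace m \<Longrightarrow> \<bar>f x - f y\<bar> \<le> L * mdist m x y"
  shows "0 \<le> lip_const m (mball_of m x r) f" "lip_const m (mball_of m x r) f \<le> L"
  using assms by (auto intro!: lip_const_nonneg[where L=L] lip_const_le)

text \<open>By \<open>lip_a_le\<close> each ball constant is at least \<open>lip_a\<close>; by
  \<open>lip_a_ge\<close> it is eventually below any larger number. Open balls replace closed ones
  because their constants have open superlevel sets.\<close>

lemma lip_const_mball_tendsto:
  assumes f: "0 \<le> K" "\<And>x y. x \<in> mspace m \<Longrightarrow> y \<in> mspace m \<Longrightarrow> \<bar>f x - f y\<bar> \<le> K * mdist m x y"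
    and \<rho>: "\<rho> \<longlonglongrightarrow> 0" "\<And>n. \<rho> n > 0"
  shows "(\<lambda>n. lip_const m (mball_of m x (\<rho> n)) f) \<longlonglongrightarrow> lip_a m f x"
proof (rule order_tendstoI)
  interpret Metric_space "mspace m" "mdist m" by simp
  have fb: "\<bar>f y - f z\<bar> \<le> K * mdist m y z" if "y \<in> mball_of m x r" "z \<in> mball_of m x r" for y z r
    using that f(2) by (auto simp: mball_of_def)
  fix c
  {
    assume c: "c < lip_a m f x"
    have "lip_a m f x \<le> lip_const m (mball_of m x (\<rho> n)) f" for n
      by (rule lip_a_le[OF f \<rho>(2)[of n] lip_const_nonneg[OF f(1) fb] lip_const_bound[OF f(1) fb]])
    then show "\<forall>\<^sub>F n in sequentially. c < lip_const m (mball_of m x (\<rho> n)) f"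
      using c less_le_trans by (intro always_eventually) blast
  next
    assume c: "lip_a m f x < c"
    obtain d where d: "lip_a m f x < d" "d < c" using c dense by blast
    obtain r where r: "r > 0"
      "\<And>y z. y \<in> mball_of m x r \<Longrightarrow> z \<in> mball_of m x r \<Longrightarrow> \<bar>f y - f z\<bar> \<le> d * mdist m y z"
      using lip_a_ge[OF f d(1)] by blast
    have "0 \<le> d" using lip_a_nonneg[OF f, of x] d by linarith
    then have "lip_const m (mball_of m x s) f \<le> d" if "s < r" for s
      using r(2) that by (intro lip_const_le) (auto simp: mball_of_def)
    moreover have "\<forall>\<^sub>F n in sequentially. \<rho> n < r" using order_tendstoD(2)[OF \<rho>(1) r(1)] .
    ultimately show "\<forall>\<^sub>F n in sequentially. lip_const m (mball_of m x (\<rho> n)) f < c"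
      using d(2) by (auto elim!: eventually_mono intro: le_less_trans)
  }
qed

text \<open>The constant at \<open>x\<close> exceeds \<open>c\<close> iff some pair
  \<open>y\<close>, \<open>z\<close> in the ball around \<open>x\<close> violates the bound
  \<open>c\<close>. By symmetry of the distance this says that \<open>x\<close> lies in the balls
  around both \<open>y\<close> and \<open>z\<close>, an open condition on \<open>x\<close>.\<close>

lemma lip_const_mball_measurable:
  assumes X: "pm_space X" and f: "bounded_lipschitz (pm_metric X) f"
  shows "(\<lambda>x. lip_const (pm_metric X) (mball_of (pm_metric X) x r) f) \<in> borel_measurable (pm_measure X)"
proof (rule borel_measurableI_greater)
  interpret Metric_space "pm_points X" "pm_dist X" by simp
  obtain L where L: "L > 0" "\<And>x y. x \<in> pm_points X \<Longrightarrow> y \<in> pm_points X \<Longrightarrow> \<bar>f x - f y\<bar> \<le> L * pm_dist X x y"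
    using bounded_lipschitzE[OF f] by metis
  let ?h = "\<lambda>x. lip_const (pm_metric X) (mball x r) f"
  have nn: "0 \<le> ?h x" for x using L by (intro lip_const_nonneg[where L=L]) auto
  fix c :: real
  have "{x \<in> space (pm_measure X). c < ?h x} \<in> sets (pm_measure X)"
  proof (cases "c < 0")
    case True
    then have "{x \<in> space (pm_measure X). c < ?h x} = space (pm_measure X)"
      using nn less_le_trans by blast
    then show ?thesis by simp
  next
    case False
    \<comment> \<open>\<open>y\<close> and \<open>z\<close> may range over the whole type, as
      \<open>mball\<close> around a point outside the space is empty.\<close>
    define U where "U = \<Union>{mball y r \<inter> mball z r | y z. \<bar>f y - f z\<bar> > c * pm_dist X y z}"
    have "{x \<in> space (pm_measure X). c < ?h x} = U"
    proof (intro equalityI subsetI)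
      fix x assume x: "x \<in> {x \<in> space (pm_measure X). c < ?h x}"
      then have "\<not> ?h x \<le> c" by simp
      then obtain y z where "y \<in> mball x r" "z \<in> mball x r" "\<bar>f y - f z\<bar> > c * pm_dist X y z"
        using lip_const_le[of c "mball x r" f "pm_metric X"] False by force
      then have "x \<in> mball y r \<inter> mball z r" "\<bar>f y - f z\<bar> > c * pm_dist X y z"
        using commute[of x y] commute[of x z] by auto
      then show "x \<in> U" unfolding U_def by blast
    next
      fix x assume "x \<in> U"
      then obtain y z where yz: "x \<in> mball y r" "x \<in> mball z r" "\<bar>f y - f z\<bar> > c * pm_dist X y z"
        unfolding U_def by blast
      then have "\<bar>f y - f z\<bar> \<le> ?h x * pm_dist X y z"
        using L commute[of x y] commute[of x z] by (intro lip_const_bound[where L=L]) auto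
      then have "c * pm_dist X y z < ?h x * pm_dist X y z" using yz(3) by linarith
      then have "c < ?h x" by (rule mult_right_less_imp_less) simp
      then show "x \<in> {x \<in> space (pm_measure X). c < ?h x}"
        using yz X by (auto simp: pm_space_def)
    qed
    moreover have "openin mtopology U" unfolding U_def by (rule openin_Union) auto
    ultimately show ?thesis using openin_pm_sets[OF X] by (simp add: mtopology_of_def)
  qed
  then show "{x \<in> space (pm_measure X). c < lip_const (pm_metric X) (mball_of (pm_metric X) x r) f}
      \<in> sets (pm_measure X)"
    by (simp add: mball_of_def)
qed

lemma lip_a_measurable:
  assumes X: "pm_space X" and f: "bounded_lipschitz (pm_metric X) f"
  shows "lip_a (pm_metric X) f \<in> borel_measurable (pm_measure X)"
proof (rule borel_measurable_LIMSEQ_real)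
  obtain L where L: "L > 0" "\<And>x y. x \<in> pm_points X \<Longrightarrow> y \<in> pm_points X \<Longrightarrow> \<bar>f x - f y\<bar> \<le> L * pm_dist X x y"
    using bounded_lipschitzE[OF f] by metis
  show "(\<lambda>n. lip_const (pm_metric X) (mball_of (pm_metric X) x (inverse (real (Suc n)))) f)
      \<longlonglongrightarrow> lip_a (pm_metric X) f x" for x
    using L by (intro lip_const_mball_tendsto[where K=L] LIMSEQ_inverse_real_of_nat) auto
qed (rule lip_const_mball_measurable[OF X f])

lemma bounded_lipschitz_measurable:
  assumes X: "pm_space X" and f: "bounded_lipschitz (pm_metric X) f"
  shows "f \<in> borel_measurable (pm_measure X)"
proof (rule borel_measurableI)
  fix S :: "real set" assume "open S"
  have "continuous_map (mtopology_of (pm_metric X)) euclidean f"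
    using f Lipschitz_continuous_imp_continuous_map[of "pm_metric X" euclidean_metric f]
    by (simp add: bounded_lipschitz_def)
  then have "openin (mtopology_of (pm_metric X)) {x \<in> topspace (mtopology_of (pm_metric X)). f x \<in> S}"
    using \<open>open S\<close> by (intro openin_continuous_map_preimage) auto
  then have "{x \<in> pm_points X. f x \<in> S} \<in> sets (pm_measure X)"
    using openin_pm_sets[OF X] by simp
  moreover have "f -` S \<inter> space (pm_measure X) = {x \<in> pm_points X. f x \<in> S}"
    using X by (auto simp: pm_space_def)
  ultimately show "f -` S \<inter> space (pm_measure X) \<in> sets (pm_measure X)" by simp
qed

lemma lip_a_le_lipschitz:
  assumes "0 \<le> K" "\<And>x y. x \<in> mspace m \<Longrightarrow> y \<in> mspace m \<Longrightarrow> \<bar>f x - f y\<bar> \<le> K * mdist m x y"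
  shows "lip_a m f x \<le> K"
  using assms by (intro lip_a_le[where r=1 and K=K]) auto

text \<open>A bounded measurable function on a probability space. Integrability has to be known for
  the monotonicity of the Bochner integral.\<close>

lemma energy_integrable:
  assumes X: "pm_space X" and f: "bounded_lipschitz (pm_metric X) f" and q: "0 \<le> q"
  shows "integrable (pm_measure X) (\<lambda>x. lip_a (pm_metric X) f x powr q)"
proof -
  interpret prob_space "pm_measure X" using X by (simp add: pm_space_def)
  note [measurable] = lip_a_measurable[OF X f]
  obtain L where L: "0 \<le> L" "\<And>x y. x \<in> pm_points X \<Longrightarrow> y \<in> pm_points X \<Longrightarrow> \<bar>f x - f y\<bar> \<le> L * pm_dist X x y"
    using bounded_lipschitzE[OF f] by (metis less_imp_le)
  show ?thesis
    using q lip_a_nonneg[OF L] lip_a_le_lipschitz[OF L]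
    by (intro integrable_const_bound[where B="L powr q"]) (auto intro!: AE_I2 powr_mono2)
qed

section \<open>The Lipschitz order\<close>

text \<open>The infimum is itself admissible when finite. This turns a finite bound in
  \<open>ennreal\<close> into an inequality between reals.\<close>

lemma poincare_const_le_iff:
  assumes c: "0 \<le> c"
  shows "poincare_const p q X \<le> ennreal c \<longleftrightarrow>
    (\<forall>f. bounded_lipschitz (pm_metric X) f \<longrightarrow> pm_variance p X f powr (1 / p)
       \<le> c * (\<integral>x. lip_a (pm_metric X) f x powr q \<partial>pm_measure X) powr (1 / q))"
    (is "_ \<longleftrightarrow> (\<forall>f. _ \<longrightarrow> ?V f \<le> c * ?E f)")
proof
  assume le: "poincare_const p q X \<le> ennreal c"
  show "\<forall>f. bounded_lipschitz (pm_metric X) f \<longrightarrow> ?V f \<le> c * ?E f"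
  proof (intro allI impI)
    fix f assume f: "bounded_lipschitz (pm_metric X) f"
    \<comment> \<open>Since the infimum lies below \<open>c + e\<close>, some admissible
      \<open>C\<close> does too; afterwards \<open>e\<close> tends to 0.\<close>
    have "?V f \<le> (c + e) * ?E f" if e: "e > 0" for e
    proof -
      have "poincare_const p q X < ennreal (c + e)"
        using le c e by (auto intro: le_less_trans simp: ennreal_less_iff)
      then obtain C where C: "C < ennreal (c + e)" "ennreal (?V f) \<le> C * ennreal (?E f)"
        unfolding poincare_const_def Inf_less_iff using f by blast
      note C(2)
      also have "C * ennreal (?E f) \<le> ennreal (c + e) * ennreal (?E f)"
        using C(1) by (intro mult_right_mono) auto
      also have "\<dots> = ennreal ((c + e) * ?E f)" using c e by (simp add: ennreal_mult)
      finally show ?thesis using c e by (simp add: ennreal_le_iff)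
    qed
    then have "\<forall>\<^sub>F e in at_right 0. ?V f \<le> (c + e) * ?E f"
      by (simp add: eventually_at_right_less eventually_mono[OF eventually_at_right_less])
    moreover have "((\<lambda>e. (c + e) * ?E f) \<longlongrightarrow> (c + 0) * ?E f) (at_right 0)"
      by (intro tendsto_intros)
    ultimately show "?V f \<le> c * ?E f"
      using tendsto_lowerbound[of "\<lambda>e. (c + e) * ?E f" _ "at_right 0"] by simp
  qed
next
  assume "\<forall>f. bounded_lipschitz (pm_metric X) f \<longrightarrow> ?V f \<le> c * ?E f"
  then have "ennreal (?V f) \<le> ennreal c * ennreal (?E f)" if "bounded_lipschitz (pm_metric X) f" for f
    using that c by (simp add: ennreal_mult[symmetric] ennreal_leI)
  then show "poincare_const p q X \<le> ennreal c" unfolding poincare_const_def by (intro Inf_lower) auto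
qed

text \<open>\<open>lipschitz_order\<close> does not ask for measurability, but the change of
  variables for \<open>distr\<close> does. A 1-Lipschitz map is continuous and therefore
  Borel.\<close>

lemma lipschitz_order_measurable:
  assumes X: "pm_space X" and Y: "pm_space Y" and \<phi>: "\<phi> \<in> pm_points Y \<rightarrow> pm_points X"
    "\<And>x y. x \<in> pm_points Y \<Longrightarrow> y \<in> pm_points Y \<Longrightarrow> pm_dist X (\<phi> x) (\<phi> y) \<le> pm_dist Y x y"
  shows "\<phi> \<in> measurable (pm_measure Y) (pm_measure X)"
proof (rule measurable_sigma_sets)
  show "sets (pm_measure X) = sigma_sets (pm_points X) {U. openin (mtopology_of (pm_metric X)) U}"
    using X by (simp add: pm_space_def)
  show "{U. openin (mtopology_of (pm_metric X)) U} \<subseteq> Pow (pm_points X)"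
    using openin_subset by fastforce
  show "\<phi> \<in> space (pm_measure Y) \<rightarrow> pm_points X" using \<phi>(1) Y by (simp add: pm_space_def)
  fix U assume "U \<in> {U. openin (mtopology_of (pm_metric X)) U}"
  moreover have "continuous_map (mtopology_of (pm_metric Y)) (mtopology_of (pm_metric X)) \<phi>"
    using \<phi> by (intro Lipschitz_continuous_imp_continuous_map)
      (auto simp: Lipschitz_continuous_map_def intro!: exI[of _ 1])
  ultimately have "openin (mtopology_of (pm_metric Y)) {x \<in> topspace (mtopology_of (pm_metric Y)). \<phi> x \<in> U}"
    by (intro openin_continuous_map_preimage) auto
  then have "{x \<in> pm_points Y. \<phi> x \<in> U} \<in> sets (pm_measure Y)"
    using openin_pm_sets[OF Y] by simp
  moreover have "\<phi> -` U \<inter> space (pm_measure Y) = {x \<in> pm_points Y. \<phi> x \<in> U}"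
    using Y by (auto simp: pm_space_def)
  ultimately show "\<phi> -` U \<inter> space (pm_measure Y) \<in> sets (pm_measure Y)" by simp
qed

text \<open>A test function \<open>f\<close> on \<open>X\<close> is pulled back to
  \<open>g = f \<circ> \<phi>\<close> on \<open>Y\<close>. The variance is unchanged and the energy
  does not grow, so each constant admissible for \<open>Y\<close> is admissible for
  \<open>X\<close>.\<close>

lemma poincare_const_mono:
  fixes X :: "'a pm" and Y :: "'b pm"
  assumes X: "pm_space X" and Y: "pm_space Y" and le: "lipschitz_order X Y" and q: "0 \<le> q"
  shows "poincare_const p q X \<le> poincare_const p q Y"
proof -
  obtain \<phi> where \<phi>: "\<phi> \<in> pm_points Y \<rightarrow> pm_points X"
    "\<And>x y. x \<in> pm_points Y \<Longrightarrow> y \<in> pm_points Y \<Longrightarrow> pm_dist X (\<phi> x) (\<phi> y) \<le> pm_dist Y x y"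
    and d: "distr (pm_measure Y) (pm_measure X) \<phi> = pm_measure X"
    using le unfolding lipschitz_order_def by blast
  note [measurable] = lipschitz_order_measurable[OF X Y \<phi>]
  have int: "(\<integral>x. h x \<partial>pm_measure X) = (\<integral>y. h (\<phi> y) \<partial>pm_measure Y)"
    if [measurable]: "h \<in> borel_measurable (pm_measure X)" for h :: "'a \<Rightarrow> real"
    by (subst d[symmetric], rule integral_distr) measurable
  show ?thesis
    unfolding poincare_const_def
  proof (rule Inf_superset_mono, intro subsetI CollectI allI impI)
    fix C f
    assume C: "C \<in> {C. \<forall>f. bounded_lipschitz (pm_metric Y) f \<longrightarrow>
     ennreal (pm_variance p Y f powr (1 / p))
       \<le> C * ennreal ((\<integral>x. lip_a (pm_metric Y) f x powr q \<partial>pm_measure Y) powr (1 / q))}"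
     and f: "bounded_lipschitz (pm_metric X) f"
    note [measurable] = bounded_lipschitz_measurable[OF X f] lip_a_measurable[OF X f]
    define g where "g = f \<circ> \<phi>"
    obtain L M where LM: "L > 0" "\<And>x y. x \<in> pm_points X \<Longrightarrow> y \<in> pm_points X \<Longrightarrow> \<bar>f x - f y\<bar> \<le> L * pm_dist X x y"
       "\<And>x. x \<in> pm_points X \<Longrightarrow> \<bar>f x\<bar> \<le> M"
      using bounded_lipschitzE[OF f] by metis
    have contract: "\<bar>g x - g y\<bar> \<le> K * pm_dist Y x y"
      if "\<bar>f (\<phi> x) - f (\<phi> y)\<bar> \<le> K * pm_dist X (\<phi> x) (\<phi> y)" "0 \<le> K" "x \<in> pm_points Y" "y \<in> pm_points Y"
      for x y K
      using that \<phi>(2)[of x y] mult_left_mono[of "pm_dist X (\<phi> x) (\<phi> y)" "pm_dist Y x y" K]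
      by (simp add: g_def)
    have gL: "\<bar>g x - g y\<bar> \<le> L * pm_dist Y x y" if "x \<in> pm_points Y" "y \<in> pm_points Y" for x y
      using that LM \<phi>(1) by (intro contract) auto
    have g: "bounded_lipschitz (pm_metric Y) g"
      using gL LM(3) \<phi>(1) by (intro bounded_lipschitzI) (auto simp: g_def)
    have L0: "0 \<le> L" using LM(1) by simp
    have lip: "lip_a (pm_metric Y) g y \<le> lip_a (pm_metric X) f (\<phi> y)" if y: "y \<in> pm_points Y" for y
    \<comment> \<open>For every \<open>K\<close> above the right-hand side, \<open>f\<close> is
      \<open>K\<close>-Lipschitz on a ball around \<open>\<phi> y\<close>, and \<open>\<phi>\<close>
      maps the ball of the same radius around \<open>y\<close> into it.\<close>
    proof (rule dense_ge)
      fix K assume K: "lip_a (pm_metric X) f (\<phi> y) < K"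
      obtain r where r: "r > 0" "\<And>x z. x \<in> mball_of (pm_metric X) (\<phi> y) r \<Longrightarrow>
          z \<in> mball_of (pm_metric X) (\<phi> y) r \<Longrightarrow> \<bar>f x - f z\<bar> \<le> K * pm_dist X x z"
        using lip_a_ge[OF L0 LM(2) K] by blast
      have K0: "0 \<le> K" using K lip_a_nonneg[OF L0 LM(2), of "\<phi> y"] by linarith
      show "lip_a (pm_metric Y) g y \<le> K"
      proof (rule lip_a_le[OF L0 gL r(1) K0])
        fix x z assume xz: "x \<in> mball_of (pm_metric Y) y r" "z \<in> mball_of (pm_metric Y) y r"
        then have "\<phi> x \<in> mball_of (pm_metric X) (\<phi> y) r" "\<phi> z \<in> mball_of (pm_metric X) (\<phi> y) r"
          using \<phi>(1) \<phi>(2)[of y x] \<phi>(2)[of y z] by auto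
        then show "\<bar>g x - g z\<bar> \<le> K * pm_dist Y x z" using xz r(2) K0 by (intro contract) auto
      qed
    qed
    have "(\<integral>y. lip_a (pm_metric Y) g y powr q \<partial>pm_measure Y)
        \<le> (\<integral>y. lip_a (pm_metric X) f (\<phi> y) powr q \<partial>pm_measure Y)"
    proof (rule integral_mono[OF energy_integrable[OF Y g q]])
      show "integrable (pm_measure Y) (\<lambda>y. lip_a (pm_metric X) f (\<phi> y) powr q)"
        using energy_integrable[OF X f q] by (subst (asm) d[symmetric]) (simp add: integrable_distr_eq)
    qed (use lip Y q lip_a_nonneg[OF L0 gL] in \<open>auto simp: pm_space_def intro!: powr_mono2\<close>)
    also have "\<dots> = (\<integral>x. lip_a (pm_metric X) f x powr q \<partial>pm_measure X)"
      by (rule int[symmetric]) measurable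
    finally have E: "(\<integral>y. lip_a (pm_metric Y) g y powr q \<partial>pm_measure Y) powr (1/q)
        \<le> (\<integral>x. lip_a (pm_metric X) f x powr q \<partial>pm_measure X) powr (1/q)"
      using q by (intro powr_mono2) auto
    have "pm_variance p X f = pm_variance p Y g"
      unfolding pm_variance_def g_def by (simp add: int o_def)
    then have "ennreal (pm_variance p X f powr (1 / p)) \<le> 
        C * ennreal ((\<integral>y. lip_a (pm_metric Y) g y powr q \<partial>pm_measure Y) powr (1 / q))"
      using C g by simp
    also have "\<dots> \<le> C * ennreal ((\<integral>x. lip_a (pm_metric X) f x powr q \<partial>pm_measure X) powr (1 / q))"
      using E by (intro mult_left_mono ennreal_leI) auto
    finally show "ennreal (pm_variance p X f powr (1 / p))
       \<le> C * ennreal ((\<integral>x. lip_a (pm_metric X) f x powr q \<partial>pm_measure X) powr (1 / q))" .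
  qed
qed

text \<open>An isomorphism lives on the support only, while \<open>lipschitz_order\<close> asks for
  a map on all points; with full supports the two domains agree.\<close>

lemma pm_iso_imp_lipschitz_order:
  assumes X: "pm_space X" "pm_supp X = pm_points X" and Y: "pm_space Y" "pm_supp Y = pm_points Y"
    and iso: "pm_iso X Y"
  shows "lipschitz_order Y X"
proof -
  obtain \<phi> where f: "\<phi> ` pm_points X = pm_points Y"
     "\<And>x y. x\<in>pm_points X \<Longrightarrow> y\<in>pm_points X \<Longrightarrow> pm_dist Y (\<phi> x) (\<phi> y) = pm_dist X x y"
     "\<And>B. B\<in>sets (pm_measure Y) \<Longrightarrow> emeasure (pm_measure X) (\<phi> -` B \<inter> pm_points X) = emeasure (pm_measure Y) B"
    using iso unfolding pm_iso_iff[OF X(1) Y(1)] X(2) Y(2) by blast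
  have m: "\<phi> \<in> measurable (pm_measure X) (pm_measure Y)"
    using f by (intro lipschitz_order_measurable[OF Y(1) X(1)]) auto
  have "distr (pm_measure X) (pm_measure Y) \<phi> = pm_measure Y"
    using f(3) X(1) by (intro measure_eqI) (auto simp: emeasure_distr[OF m] pm_space_def)
  then show ?thesis unfolding lipschitz_order_def using f by (intro exI[of _ \<phi>]) auto
qed

lemma poincare_const_iso:
  assumes X: "pm_space X" "pm_supp X = pm_points X" and Y: "pm_space Y" "pm_supp Y = pm_points Y"
    and iso: "pm_iso X Y" and q: "0 \<le> q"
  shows "poincare_const p q X = poincare_const p q Y"
  using poincare_const_mono[OF X(1) Y(1) pm_iso_imp_lipschitz_order[OF Y X pm_iso_sym[OF X(1) Y(1) iso]] q]
    poincare_const_mono[OF Y(1) X(1) pm_iso_imp_lipschitz_order[OF X Y iso] q]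
  by (rule antisym)

section \<open>Scaling\<close>

context
  fixes X :: "'a pm" and t :: real
  assumes t: "t > 0"
begin

text \<open>The projections of \<open>metric\<close> recover the given pair only after it has been
  shown to be a metric space, which is where \<open>t > 0\<close> enters.\<close>

lemma pm_points_scale: "pm_points (pm_scale t X) = pm_points X"
  and pm_dist_scale: "pm_dist (pm_scale t X) = (\<lambda>x y. t * pm_dist X x y)"
proof -
  interpret Metric_space "pm_points X" "pm_dist X" by simp
  interpret T: Metric_space "pm_points X" "\<lambda>x y. t * pm_dist X x y"
  proof
    show "t * pm_dist X x z \<le> t * pm_dist X x y + t * pm_dist X y z"
      if "x \<in> pm_points X" "y \<in> pm_points X" "z \<in> pm_points X" for x y z
      using triangle[OF that] t by (simp flip: distrib_left)
  qed (use t in \<open>auto simp: commute\<close>)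
  show "pm_points (pm_scale t X) = pm_points X" "pm_dist (pm_scale t X) = (\<lambda>x y. t * pm_dist X x y)"
    by (simp_all add: pm_scale_def)
qed

lemma pm_measure_scale: "pm_measure (pm_scale t X) = pm_measure X"
  by (simp add: pm_scale_def)

lemma mball_of_scale: "mball_of (pm_metric (pm_scale t X)) x (t * r) = mball_of (pm_metric X) x r"
  using t by (auto simp: pm_points_scale pm_dist_scale)

lemma mtopology_of_scale: "mtopology_of (pm_metric (pm_scale t X)) = mtopology_of (pm_metric X)"
proof -
  interpret A: Metric_space "pm_points X" "pm_dist X" by simp
  interpret B: Metric_space "pm_points X" "pm_dist (pm_scale t X)"
    using Metric_space_mspace_mdist[of "pm_metric (pm_scale t X)"] by (simp add: pm_points_scale)
  have ball: "B.mball x (t * r) = A.mball x r" for x r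
    using mball_of_scale by (simp add: mball_of_def pm_points_scale)
  have "(\<exists>r>0. B.mball x r \<subseteq> U) \<longleftrightarrow> (\<exists>r>0. A.mball x r \<subseteq> U)" for x U
  proof
    assume "\<exists>r>0. B.mball x r \<subseteq> U"
    then obtain r where "r > 0" "B.mball x r \<subseteq> U" by blast
    then show "\<exists>r>0. A.mball x r \<subseteq> U" using ball[of x "r / t"] t by (intro exI[of _ "r/t"]) auto
  next
    assume "\<exists>r>0. A.mball x r \<subseteq> U"
    then obtain r where "r > 0" "A.mball x r \<subseteq> U" by blast
    then show "\<exists>r>0. B.mball x r \<subseteq> U" using ball[of x r] t by (intro exI[of _ "t * r"]) auto
  qed
  then have "openin B.mtopology U \<longleftrightarrow> openin A.mtopology U" for U
    unfolding A.openin_mtopology B.openin_mtopology by simp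
  then show ?thesis by (simp add: mtopology_of_def topology_eq pm_points_scale)
qed

lemma pm_supp_scale: "pm_supp (pm_scale t X) = pm_supp X"
  by (simp add: pm_supp_def pm_points_scale pm_measure_scale mtopology_of_scale)

text \<open>Topology and measure do not change under scaling. Only completeness needs an argument: a
  Cauchy sequence for the scaled distance is Cauchy for the original one.\<close>

lemma pm_space_scale:
  assumes X: "pm_space X"
  shows "pm_space (pm_scale t X)"
proof -
  interpret A: Metric_space "pm_points X" "pm_dist X" by simp
  interpret B: Metric_space "pm_points X" "pm_dist (pm_scale t X)"
    using Metric_space_mspace_mdist[of "pm_metric (pm_scale t X)"] by (simp add: pm_points_scale)
  have "A.MCauchy \<sigma>" if c: "B.MCauchy \<sigma>" for \<sigma>
    unfolding A.MCauchy_def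
  proof (intro conjI allI impI)
    show "range \<sigma> \<subseteq> pm_points X" using c unfolding B.MCauchy_def by blast
    fix e :: real assume "e > 0"
    then have "t * e > 0" using t by simp
    then obtain N where "\<forall>n n'. N \<le> n \<longrightarrow> N \<le> n' \<longrightarrow> pm_dist (pm_scale t X) (\<sigma> n) (\<sigma> n') < t * e"
      using c unfolding B.MCauchy_def by blast
    then show "\<exists>N. \<forall>n n'. N \<le> n \<longrightarrow> N \<le> n' \<longrightarrow> pm_dist X (\<sigma> n) (\<sigma> n') < e" using t by (auto simp: pm_dist_scale)
  qed
  moreover have "B.mtopology = A.mtopology" using mtopology_of_scale by (simp add: mtopology_of_def pm_points_scale)
  ultimately have "mcomplete_of (pm_metric (pm_scale t X))"
    using X unfolding pm_space_def mcomplete_of_def pm_points_scale A.mcomplete_def B.mcomplete_def by auto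
  then show ?thesis
    using X by (simp add: pm_space_def pm_points_scale pm_measure_scale mtopology_of_scale)
qed

text \<open>The variance does not see the metric, and \<open>lip_a\<close> on \<open>X\<close> is at
  most \<open>t\<close> times \<open>lip_a\<close> on the scaled space. The reverse inequality will
  come from scaling back by \<open>1/t\<close>.\<close>

lemma poincare_const_scale_le:
  assumes X: "pm_space X" and q: "0 < q"
  shows "poincare_const p q (pm_scale t X) \<le> ennreal t * poincare_const p q X"
proof (cases "poincare_const p q X")
  case (real c)
  note Xt = pm_space_scale[OF X]
  let ?l = "lip_a (pm_metric X)" and ?lt = "lip_a (pm_metric (pm_scale t X))"
  have "poincare_const p q (pm_scale t X) \<le> ennreal (t * c)"
  proof (subst poincare_const_le_iff, use t real in simp, intro allI impI)
    fix f assume f: "bounded_lipschitz (pm_metric (pm_scale t X)) f"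
    obtain L M where LM: "L > 0" "\<And>x y. x \<in> pm_points X \<Longrightarrow> y \<in> pm_points X \<Longrightarrow> \<bar>f x - f y\<bar> \<le> L * (t * pm_dist X x y)"
       "\<And>x. x \<in> pm_points X \<Longrightarrow> \<bar>f x\<bar> \<le> M"
      using bounded_lipschitzE[OF f] unfolding pm_points_scale pm_dist_scale by metis
    have L: "0 \<le> L * t" "\<And>x y. x \<in> pm_points X \<Longrightarrow> y \<in> pm_points X \<Longrightarrow> \<bar>f x - f y\<bar> \<le> L * t * pm_dist X x y"
      using LM t by (auto simp: mult.assoc)
    have Lt: "0 \<le> L" "\<And>x y. x \<in> pm_points (pm_scale t X) \<Longrightarrow> y \<in> pm_points (pm_scale t X) \<Longrightarrow>
        \<bar>f x - f y\<bar> \<le> L * pm_dist (pm_scale t X) x y"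
      using LM by (auto simp: pm_points_scale pm_dist_scale)
    have fX: "bounded_lipschitz (pm_metric X) f" using L LM by (intro bounded_lipschitzI) auto
    have lip: "?l f x \<le> t * ?lt f x" for x
    proof (rule dense_ge)
      fix K assume "t * ?lt f x < K"
      then have K: "?lt f x < K / t" using t by (simp add: field_simps)
      obtain r where r: "r > 0" "\<And>y z. y \<in> mball_of (pm_metric (pm_scale t X)) x r \<Longrightarrow>
         z \<in> mball_of (pm_metric (pm_scale t X)) x r \<Longrightarrow> \<bar>f y - f z\<bar> \<le> K / t * pm_dist (pm_scale t X) y z"
        using lip_a_ge[OF Lt K] by blast
      have "0 \<le> K / t" using K lip_a_nonneg[OF Lt, of x] by linarith
      then have K0: "0 \<le> K" using t by (simp add: zero_le_divide_iff)
      show "?l f x \<le> K"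
      proof (rule lip_a_le[OF L _ K0])
        show "0 < r / t" using r t by simp
        show "\<bar>f y - f z\<bar> \<le> K * pm_dist X y z"
          if "y \<in> mball_of (pm_metric X) x (r/t)" "z \<in> mball_of (pm_metric X) x (r/t)" for y z
        proof -
          have "mball_of (pm_metric (pm_scale t X)) x r = mball_of (pm_metric X) x (r/t)"
            using t mball_of_scale[of x "r/t"] by simp
          then show ?thesis using r(2)[of y z] that t by (simp only: pm_dist_scale) simp
        qed
      qed
    qed
    have "(\<integral>x. ?l f x powr q \<partial>pm_measure X) \<le> (\<integral>x. t powr q * ?lt f x powr q \<partial>pm_measure X)"
    proof (rule integral_mono[OF energy_integrable[OF X fX]])
      show "integrable (pm_measure X) (\<lambda>x. t powr q * ?lt f x powr q)"
        using energy_integrable[OF Xt f, of q] q by (simp add: pm_measure_scale)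
      show "?l f x powr q \<le> t powr q * ?lt f x powr q" for x
        using powr_mono2[OF _ lip_a_nonneg[OF L] lip[of x], of q] q t lip_a_nonneg[OF Lt, of x]
        by (simp add: powr_mult)
    qed (use q in simp)
    also have "\<dots> = t powr q * (\<integral>x. ?lt f x powr q \<partial>pm_measure X)" by simp
    finally have "(\<integral>x. ?l f x powr q \<partial>pm_measure X) powr (1/q)
        \<le> (t powr q * (\<integral>x. ?lt f x powr q \<partial>pm_measure X)) powr (1/q)"
      using q by (intro powr_mono2) auto
    also have "\<dots> = t * (\<integral>x. ?lt f x powr q \<partial>pm_measure X) powr (1/q)"
      using q t by (simp add: powr_mult powr_powr)
    finally have E: "(\<integral>x. ?l f x powr q \<partial>pm_measure X) powr (1/q) \<le> \<dots>" .
    have "pm_variance p (pm_scale t X) f powr (1/p) = pm_variance p X f powr (1/p)"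
      by (simp add: pm_variance_def pm_measure_scale)
    also have "\<dots> \<le> c * (\<integral>x. ?l f x powr q \<partial>pm_measure X) powr (1/q)"
      using poincare_const_le_iff[of c p q X] real fX by simp
    also have "\<dots> \<le> c * (t * (\<integral>x. ?lt f x powr q \<partial>pm_measure X) powr (1/q))"
      using E real by (intro mult_left_mono) auto
    finally show "pm_variance p (pm_scale t X) f powr (1/p)
        \<le> t * c * (\<integral>x. ?lt f x powr q \<partial>pm_measure (pm_scale t X)) powr (1/q)"
      by (simp add: pm_measure_scale mult_ac)
  qed
  then show ?thesis using real t by (simp add: ennreal_mult)
next
  case top
  then show ?thesis using t by (simp add: ennreal_mult_top)
qed

end

lemma pm_scale_inverse:
  assumes "t > 0"
  shows "pm_scale (1/t) (pm_scale t X) = X"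
proof -
  have "pm_scale (1/t) (pm_scale t X) = (metric (pm_points X, pm_dist X), pm_measure X)"
    unfolding pm_scale_def[of "1/t"] using assms
    by (simp add: pm_points_scale pm_dist_scale pm_measure_scale)
  then show ?thesis by simp
qed

lemma poincare_const_scale:
  assumes t: "t > 0" and X: "pm_space X" and q: "0 < q"
  shows "poincare_const p q (pm_scale t X) = ennreal t * poincare_const p q X"
proof (rule antisym)
  show "poincare_const p q (pm_scale t X) \<le> ennreal t * poincare_const p q X"
    by (rule poincare_const_scale_le[OF t X q])
  have "poincare_const p q X \<le> ennreal (1/t) * poincare_const p q (pm_scale t X)"
    using poincare_const_scale_le[of "1/t" "pm_scale t X" q p] pm_space_scale[OF t X] t q
    by (simp add: pm_scale_inverse)
  then have "ennreal t * poincare_const p q X \<le> ennreal t * (ennreal (1/t) * poincare_const p q (pm_scale t X))"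
    by (rule mult_left_mono) simp
  also have "\<dots> = poincare_const p q (pm_scale t X)"
    using t by (simp add: mult.assoc[symmetric] ennreal_mult[symmetric])
  finally show "ennreal t * poincare_const p q X \<le> poincare_const p q (pm_scale t X)" .
qed

section \<open>Monotonicity and homogeneity on isomorphism classes\<close>

lemma class_poincare_const_monotone:
  assumes "0 \<le> q"
  shows "class_monotone (class_poincare_const p q)"
  unfolding class_monotone_def class_poincare_const_def class_order_def
  using poincare_const_mono pm_rep(2) assms by blast

text \<open>The representative chosen for the scaled class is only isomorphic to the scaled
  representative. Both have full support, so \<open>poincare_const_iso\<close> identifies their
  constants.\<close>

lemma class_poincare_const_1_homogeneous:
  assumes q: "0 < q"
  shows "class_1_homogeneous (class_poincare_const p q)"
  unfolding class_1_homogeneous_def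
proof (intro ballI allI impI)
  fix \<X> and t :: real assume \<X>: "\<X> \<in> pm_classes" and t: "t > 0"
  let ?X = "pm_rep \<X>"
  note X = pm_rep[OF \<X>]
  have S: "pm_space (pm_scale t ?X)" "pm_supp (pm_scale t ?X) = pm_points (pm_scale t ?X)"
    using X t by (simp_all add: pm_space_scale pm_supp_scale pm_points_scale)
  have cl: "class_scale t \<X> \<in> pm_classes"
    unfolding class_scale_def by (rule pm_class_in_pm_classes[OF S(1)])
  note Z = pm_rep[OF cl]
  have "pm_iso (pm_scale t ?X) (pm_rep (class_scale t \<X>))"
    using Z(1) by (simp add: class_scale_def pm_class_def)
  then have "poincare_const p q (pm_rep (class_scale t \<X>)) = poincare_const p q (pm_scale t ?X)"
    using poincare_const_iso[OF S Z(2,3)] q by simp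
  then show "class_poincare_const p q (class_scale t \<X>) = ennreal t * class_poincare_const p q \<X>"
    using poincare_const_scale[OF t X(2) q] by (simp add: class_poincare_const_def)
qed

section \<open>Lower semicontinuity\<close>

text \<open>If \<open>u \<le> v\<close> the left side is nonpositive. Otherwise the mean value
  theorem gives a derivative \<open>p * z powr (p - 1)\<close> with
  \<open>z < u \<le> K\<close>.\<close>

lemma powr_diff_le:
  fixes p u v K :: real
  assumes p: "1 \<le> p" and uv: "0 \<le> u" "0 \<le> v" "u \<le> K"
  shows "u powr p - v powr p \<le> p * K powr (p - 1) * \<bar>u - v\<bar>"
proof (cases "u \<le> v")
  case True
  then have "u powr p - v powr p \<le> 0" using p uv by (simp add: powr_mono2)
  also have "0 \<le> p * K powr (p - 1) * \<bar>u - v\<bar>" using p by simp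
  finally show ?thesis .
next
  case False
  have "\<exists>l z. v < z \<and> z < u \<and> DERIV (\<lambda>x. x powr p) z :> l \<and> u powr p - v powr p = (u - v) * l"
  proof (rule MVT)
    show "continuous_on {v..u} (\<lambda>x. x powr p)" using uv p by (intro continuous_on_powr') (auto intro!: continuous_intros)
    show "(\<lambda>x. x powr p) differentiable (at x)" if "v < x" "x < u" for x
      using has_real_derivative_powr[of x p] that uv real_differentiable_def by auto
  qed (use False in auto)
  then obtain l z where z: "v < z" "z < u" "DERIV (\<lambda>x. x powr p) z :> l" "u powr p - v powr p = (u - v) * l"
    by blast
  have "l = p * z powr (p - 1)"
    using z uv by (intro DERIV_unique[OF z(3)] has_real_derivative_powr) auto
  moreover have "z powr (p - 1) \<le> K powr (p - 1)" using z uv p by (intro powr_mono2) auto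
  ultimately have "l \<le> p * K powr (p - 1)" using p by simp
  then have "(u - v) * l \<le> (u - v) * (p * K powr (p - 1))" using False by (intro mult_left_mono) auto
  then show ?thesis using z(4) False by (simp add: mult_ac)
qed

text \<open>The McShane-type formula \<open>\<Phi> s\<close> below uses the local Lipschitz constant as slope at distances up
  to \<open>r\<close> and adds a steep slope beyond. The extra slope \<open>\<eta>\<close> makes the points \<open>b s\<close> at distance at least
  \<open>r / 2\<close> from \<open>b t\<close> irrelevant for the infimum near \<open>b t\<close>, even after an error of size \<open>\<epsilon>\<close>.\<close>

lemma local_lipschitz_transfer:
  fixes m :: "'a metric" and m' :: "'b metric" and a :: "'i \<Rightarrow> 'a" and b :: "'i \<Rightarrow> 'b"
  assumes I: "I \<noteq> {}" "\<And>s. s \<in> I \<Longrightarrow> a s \<in> mspace m" "\<And>s. s \<in> I \<Longrightarrow> b s \<in> mspace m'"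
    and close: "\<And>s t. s \<in> I \<Longrightarrow> t \<in> I \<Longrightarrow> \<bar>mdist m (a s) (a t) - mdist m' (b s) (b t)\<bar> \<le> \<epsilon>"
    and f: "L > 0" "\<And>x y. x \<in> mspace m \<Longrightarrow> y \<in> mspace m \<Longrightarrow> \<bar>f x - f y\<bar> \<le> L * mdist m x y"
      "\<And>x. x \<in> mspace m \<Longrightarrow> \<bar>f x\<bar> \<le> M"
    and r: "r > 0" "\<eta> > 0" "0 \<le> \<epsilon>" "\<epsilon> < r / 2" "8 * L * \<epsilon> \<le> \<eta> * r"
  obtains F where
    "\<And>y z. y \<in> mspace m' \<Longrightarrow> z \<in> mspace m' \<Longrightarrow> \<bar>F y - F z\<bar> \<le> (3 * L + \<eta>) * mdist m' y z"
    "\<And>y. y \<in> mspace m' \<Longrightarrow> \<bar>F y\<bar> \<le> M"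
    "\<And>t. t \<in> I \<Longrightarrow> \<bar>F (b t) - f (a t)\<bar> \<le> 2 * L * \<epsilon>"
    "\<And>t. t \<in> I \<Longrightarrow> lip_a m' F (b t) \<le> lip_const m (mball_of m (a t) (3 * r)) f + \<eta>"
proof -
  interpret B: Metric_space "mspace m'" "mdist m'" by simp
  define H where "H x \<rho> = lip_const m (mball_of m x \<rho>) f" for x \<rho>
  have fb: "\<bar>f y - f z\<bar> \<le> L * mdist m y z" if "y \<in> mball_of m x \<rho>" "z \<in> mball_of m x \<rho>" for x y z \<rho>
    using that f(2) by auto
  have L0: "0 \<le> L" using f(1) by simp
  have H0: "0 \<le> H x \<rho>" for x \<rho> unfolding H_def by (rule lip_const_nonneg[OF L0 fb])
  have HL: "H x \<rho> \<le> L" for x \<rho> unfolding H_def by (rule lip_const_le[OF L0 fb])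
  have Hb: "\<bar>f y - f z\<bar> \<le> H x \<rho> * mdist m y z" if "y \<in> mball_of m x \<rho>" "z \<in> mball_of m x \<rho>" for x y z \<rho>
    unfolding H_def by (rule lip_const_bound[OF L0 fb that])
  \<comment> \<open>The first slope in \<open>\<Phi>\<close> is at most \<open>L + \<eta>\<close>
    and the steep term adds \<open>2 * L\<close>.\<close>
  define K where "K = 3 * L + \<eta>"
  have K0: "0 < K" using f r by (simp add: K_def)
  define \<Phi> where "\<Phi> s y = f (a s) + (H (a s) (2 * r) + \<eta>) * mdist m' (b s) y
      + 2 * L * max 0 (mdist m' (b s) y - r)" for s y
  have tri: "mdist m' (b s) y \<le> mdist m' (b s) z + mdist m' y z"
    if "s \<in> I" "y \<in> mspace m'" "z \<in> mspace m'" for s y z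
    using B.triangle[of "b s" z y] I(3)[of s] that B.commute[of z y] by simp
  have \<Phi>_lip: "\<Phi> s y \<le> \<Phi> s z + K * mdist m' y z"
    if s: "s \<in> I" "y \<in> mspace m'" "z \<in> mspace m'" for s y z
  proof -
    have "(H (a s) (2 * r) + \<eta>) * mdist m' (b s) y \<le> (H (a s) (2 * r) + \<eta>) * (mdist m' (b s) z + mdist m' y z)"
      using tri[OF s] H0[of "a s" "2 * r"] r by (intro mult_left_mono) auto
    moreover have "(H (a s) (2 * r) + \<eta>) * mdist m' y z \<le> (L + \<eta>) * mdist m' y z"
      using HL by (intro mult_right_mono) auto
    moreover have "2 * L * max 0 (mdist m' (b s) y - r) \<le> 2 * L * (max 0 (mdist m' (b s) z - r) + mdist m' y z)"
      using tri[OF s] L0 B.nonneg[of y z] by (intro mult_left_mono) auto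
    ultimately show ?thesis unfolding \<Phi>_def K_def by (simp add: algebra_simps)
  qed
  \<comment> \<open>At \<open>y\<close> the steep term vanishes and at \<open>z\<close> it is
    nonnegative, so the local slope alone controls this one-sided comparison.\<close>
  have \<Phi>_near: "\<Phi> s y \<le> \<Phi> s z + (H (a s) (2 * r) + \<eta>) * mdist m' y z"
    if s: "s \<in> I" "y \<in> mspace m'" "z \<in> mspace m'" and n: "mdist m' (b s) y \<le> r" for s y z
  proof -
    have "(H (a s) (2 * r) + \<eta>) * mdist m' (b s) y \<le> (H (a s) (2 * r) + \<eta>) * (mdist m' (b s) z + mdist m' y z)"
      using tri[OF s] H0[of "a s" "2 * r"] r by (intro mult_left_mono) auto
    moreover have "0 \<le> 2 * L * max 0 (mdist m' (b s) z - r)" using L0 by simp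
    ultimately show ?thesis unfolding \<Phi>_def using n by (simp add: algebra_simps)
  qed
  \<comment> \<open>Up to the error, no index undercuts \<open>f (a t)\<close> at
    \<open>b t\<close>; the surplus \<open>\<eta>\<close> times the distance will exclude distant
    indices.\<close>
  have \<Phi>_low: "f (a t) + \<eta> * mdist m' (b s) (b t) - 2 * L * \<epsilon> \<le> \<Phi> s (b t)" if s: "s \<in> I" "t \<in> I" for s t
  proof -
    let ?d = "mdist m (a s) (a t)" and ?\<rho> = "mdist m' (b s) (b t)" and ?H = "H (a s) (2 * r)"
    have c: "?d \<le> ?\<rho> + \<epsilon>" using close[OF s] by linarith
    show ?thesis
    proof (cases "?d < 2 * r")
      case True
      have "mdist m (a s) (a s) = 0" using I(2)[OF s(1)] by simp
      then have "\<bar>f (a s) - f (a t)\<bar> \<le> ?H * ?d"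
        using True I(2)[OF s(1)] I(2)[OF s(2)] r by (intro Hb) (simp_all only: in_mball_of, simp_all)
      also have "\<dots> \<le> ?H * (?\<rho> + \<epsilon>)" using c H0 by (intro mult_left_mono) auto
      finally have "f (a t) \<le> f (a s) + ?H * ?\<rho> + ?H * \<epsilon>" by (simp add: algebra_simps)
      moreover have "?H * \<epsilon> \<le> L * \<epsilon>" using HL r by (intro mult_right_mono) auto
      moreover have "0 \<le> 2 * L * max 0 (?\<rho> - r)" "0 \<le> L * \<epsilon>" using L0 r by simp_all
      ultimately show ?thesis unfolding \<Phi>_def by (simp add: algebra_simps)
    next
      case False
      \<comment> \<open>From \<open>?d \<ge> 2 * r\<close> follows \<open>?d \<le> 2 * (?d - r)
        \<le> 2 * (?\<rho> - r) + 2 * \<epsilon>\<close>. Hence slope \<open>2 * L\<close> beyond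
        \<open>r\<close> pays for the global Lipschitz bound up to
        \<open>2 * L * \<epsilon>\<close>.\<close>
      have "\<bar>f (a s) - f (a t)\<bar> \<le> L * ?d" using s I(2) f by auto
      moreover have "L * ?d \<le> L * (2 * (?\<rho> - r) + 2 * \<epsilon>)"
        using False c L0 by (intro mult_left_mono) auto
      moreover have "2 * L * (?\<rho> - r) \<le> 2 * L * max 0 (?\<rho> - r)" using L0 by (intro mult_left_mono) auto
      moreover have "0 \<le> ?H * ?\<rho>" using H0 by simp
      ultimately show ?thesis unfolding \<Phi>_def by (simp add: algebra_simps)
    qed
  qed
  have \<Phi>_ge: "- M \<le> \<Phi> s y" if "s \<in> I" for s y
  proof -
    have "- M \<le> f (a s)" using f(3)[of "a s"] I(2)[OF that] by simp
    moreover have "0 \<le> (H (a s) (2 * r) + \<eta>) * mdist m' (b s) y" using H0 r by (simp add: add_nonneg_nonneg)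
    moreover have "0 \<le> 2 * L * max 0 (mdist m' (b s) y - r)" using L0 by simp
    ultimately show ?thesis unfolding \<Phi>_def by linarith
  qed
  obtain s0 where s0: "s0 \<in> I" using I(1) by blast
  have M0: "0 \<le> M" using f(3)[of "a s0"] I(2)[OF s0] by simp
  \<comment> \<open>Truncation at \<open>M\<close> bounds \<open>F\<close> from above and preserves
    the Lipschitz estimates; the bound from below comes from \<open>\<Phi>_ge\<close>.\<close>
  define F where "F y = (INF s\<in>I. min M (\<Phi> s y))" for y
  have bdd: "bdd_below ((\<lambda>s. min M (\<Phi> s y)) ` I)" for y
    using \<Phi>_ge M0 by (intro bdd_belowI[of _ "- M"]) auto
  have F_le: "F y \<le> min M (\<Phi> s y)" if "s \<in> I" for s y
    unfolding F_def by (rule cINF_lower[OF bdd that])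
  have F_ge: "c \<le> F y" if "\<And>s. s \<in> I \<Longrightarrow> c \<le> min M (\<Phi> s y)" for c y
    unfolding F_def using I(1) that by (rule cINF_greatest)
  have F_lip1: "F y \<le> F z + K * mdist m' y z" if yz: "y \<in> mspace m'" "z \<in> mspace m'" for y z
  proof -
    have "F y - K * mdist m' y z \<le> F z"
    proof (rule F_ge)
      fix s assume s: "s \<in> I"
      have "0 \<le> K * mdist m' y z" using K0 by simp
      then show "F y - K * mdist m' y z \<le> min M (\<Phi> s z)"
        using F_le[OF s, of y] \<Phi>_lip[OF s yz] by linarith
    qed
    then show ?thesis by simp
  qed
  have F_lip: "\<bar>F y - F z\<bar> \<le> K * mdist m' y z" if "y \<in> mspace m'" "z \<in> mspace m'" for y z
    using F_lip1[OF that] F_lip1[OF that(2,1)] B.commute[of y z] by (simp add: abs_le_iff)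
  have F_bdd: "\<bar>F y\<bar> \<le> M" for y
    using F_le[OF s0, of y] F_ge[of "- M" y] \<Phi>_ge M0 by (simp add: abs_le_iff)
  have F_up: "F (b t) \<le> f (a t)" if t: "t \<in> I" for t
  proof -
    have "\<Phi> t (b t) = f (a t)" using I(3)[OF t] r by (simp add: \<Phi>_def)
    then show ?thesis using F_le[OF t, of "b t"] by simp
  qed
  have F_low: "f (a t) - 2 * L * \<epsilon> \<le> F (b t)" if t: "t \<in> I" for t
  proof (rule F_ge)
    fix s assume s: "s \<in> I"
    have "0 \<le> \<eta> * mdist m' (b s) (b t)" "0 \<le> L * \<epsilon>" using r L0 by simp_all
    then show "f (a t) - 2 * L * \<epsilon> \<le> min M (\<Phi> s (b t))"
      using \<Phi>_low[OF s t] f(3)[OF I(2)[OF t]] by simp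
  qed
  have loc: "lip_a m' F (b t) \<le> H (a t) (3 * r) + \<eta>" if t: "t \<in> I" for t
  proof -
    \<comment> \<open>The first bound keeps points of the \<open>\<delta>\<close>-ball within
      \<open>r\<close> of \<open>b s\<close> when \<open>b s\<close> is within \<open>r / 2\<close>
      of \<open>b t\<close>. The second makes a move inside the ball cost at most
      \<open>\<eta> * r / 8\<close>.\<close>
    define \<delta> where "\<delta> = min (r / 2) (\<eta> * r / (8 * K))"
    have \<delta>: "\<delta> > 0" "\<delta> \<le> r / 2" using r K0 by (simp_all add: \<delta>_def)
    have "\<delta> \<le> \<eta> * r / (8 * K)" by (simp add: \<delta>_def)
    then have K\<delta>: "8 * (K * \<delta>) \<le> \<eta> * r" using K0 by (simp add: field_simps)
    let ?\<Lambda> = "H (a t) (3 * r) + \<eta>"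
    have one: "F y - ?\<Lambda> * mdist m' y z \<le> F z"
      if y: "y \<in> mspace m'" "mdist m' (b t) y < \<delta>" and z: "z \<in> mspace m'" "mdist m' (b t) z < \<delta>" for y z
    proof (rule F_ge)
      fix s assume s: "s \<in> I"
      have \<Lambda>d: "0 \<le> ?\<Lambda> * mdist m' y z" using H0 r by (simp add: add_nonneg_nonneg)
      have FM: "F y \<le> M" using F_bdd[of y] by simp
      show "F y - ?\<Lambda> * mdist m' y z \<le> min M (\<Phi> s z)"
      proof (cases "mdist m' (b s) (b t) < r / 2")
        case True
        \<comment> \<open>Near indices: \<open>\<Phi>_near\<close> applies, and since
          \<open>a s\<close> is within \<open>r\<close> of \<open>a t\<close>, its slope is bounded
          by the constant on the larger ball around \<open>a t\<close>.\<close>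
        have sy: "mdist m' (b s) y \<le> r"
          using tri[OF s y(1) I(3)[OF t]] y(2) True \<delta> B.commute[of y "b t"] by linarith
        have ast: "mdist m (a s) (a t) < r" using close[OF s t] True r by linarith
        have "mball_of m (a s) (2 * r) \<subseteq> mball_of m (a t) (3 * r)"
        proof
          fix w assume w: "w \<in> mball_of m (a s) (2 * r)"
          have "mdist m (a t) w \<le> mdist m (a t) (a s) + mdist m (a s) w"
            using w I(2) s t by (intro mdist_triangle) auto
          then show "w \<in> mball_of m (a t) (3 * r)"
            using w ast I(2)[OF t] mdist_commute[of m "a s" "a t"] by auto
        qed
        then have "H (a s) (2 * r) \<le> H (a t) (3 * r)"
          unfolding H_def using L0 fb by (intro lip_const_mono[where L=L]) auto
        then have "(H (a s) (2 * r) + \<eta>) * mdist m' y z \<le> ?\<Lambda> * mdist m' y z"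
          by (intro mult_right_mono) auto
        then have "\<Phi> s y \<le> \<Phi> s z + ?\<Lambda> * mdist m' y z"
          using \<Phi>_near[OF s y(1) z(1) sy] by linarith
        then show ?thesis using F_le[OF s, of y] \<Lambda>d by linarith
      next
        case False
        \<comment> \<open>Far indices: the surplus is at least \<open>\<eta> * r / 2\<close>. It
          covers the error \<open>2 * L * \<epsilon> \<le> \<eta> * r / 4\<close> and two moves of
          cost at most \<open>\<eta> * r / 8\<close>, from \<open>b t\<close> to \<open>y\<close>
          and to \<open>z\<close>.\<close>
        have "\<eta> * r \<le> \<eta> * (2 * mdist m' (b s) (b t))" using False r by (intro mult_left_mono) auto
        then have "\<eta> * r \<le> 2 * (\<eta> * mdist m' (b s) (b t))" by simp
        moreover have "\<Phi> s (b t) \<le> \<Phi> s z + K * mdist m' (b t) z" by (rule \<Phi>_lip[OF s I(3)[OF t] z(1)])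
        moreover have "K * mdist m' (b t) z \<le> K * \<delta>" "K * mdist m' (b t) y \<le> K * \<delta>"
          using K0 z(2) y(2) by (auto intro!: mult_left_mono)
        moreover have "F y \<le> F (b t) + K * mdist m' (b t) y"
          using F_lip1[OF y(1) I(3)[OF t]] B.commute[of y "b t"] by simp
        ultimately have "F y \<le> \<Phi> s z"
          using \<Phi>_low[OF s t] F_up[OF t] K\<delta> r by linarith
        then show ?thesis using FM \<Lambda>d by linarith
      qed
    qed
    show ?thesis
    proof (rule lip_a_le[of K m' F \<delta>])
      show "\<bar>F y - F z\<bar> \<le> ?\<Lambda> * mdist m' y z" if "y \<in> mball_of m' (b t) \<delta>" "z \<in> mball_of m' (b t) \<delta>" for y z
        using one[of y z] one[of z y] that B.commute[of y z] by (simp add: abs_le_iff)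
    qed (use K0 F_lip \<delta> H0 r in \<open>auto simp: add_nonneg_nonneg\<close>)
  qed
  show ?thesis
  proof (rule that[of F])
    show "\<bar>F (b t) - f (a t)\<bar> \<le> 2 * L * \<epsilon>" if "t \<in> I" for t
      using F_up[OF that] F_low[OF that] L0 r by (simp add: abs_le_iff)
  qed (use F_lip F_bdd loc in \<open>auto simp: K_def H_def\<close>)
qed

section \<open>Integration over parameters and passage to the limit\<close>

lemma prob_space_unit_lebesgue: "prob_space unit_lebesgue"
  by (rule prob_space_restrict_space) auto

lemma pm_parameterD:
  fixes h :: "'a \<Rightarrow> real"
  assumes "pm_space X" "pm_parameter X a"
  shows "a \<in> measurable unit_lebesgue (pm_measure X)"
    and "s \<in> space unit_lebesgue \<Longrightarrow> a s \<in> pm_points X"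
    and "h \<in> borel_measurable (pm_measure X) \<Longrightarrow>
      (\<integral>x. h x \<partial>pm_measure X) = (\<integral>s. h (a s) \<partial>unit_lebesgue)"
proof -
  show m: "a \<in> measurable unit_lebesgue (pm_measure X)"
    using assms(2) by (simp add: pm_parameter_def)
  show "s \<in> space unit_lebesgue \<Longrightarrow> a s \<in> pm_points X"
    using measurable_space[OF m] assms(1) by (simp add: pm_space_def)
  have d: "distr unit_lebesgue (pm_measure X) a = pm_measure X"
    using assms(2) by (simp add: pm_parameter_def)
  show "h \<in> borel_measurable (pm_measure X) \<Longrightarrow>
      (\<integral>x. h x \<partial>pm_measure X) = (\<integral>s. h (a s) \<partial>unit_lebesgue)"
    using integral_distr[OF m, of h] by (simp add: d)
qed

text \<open>The function \<open>F\<close> from \<open>local_lipschitz_transfer\<close> is inserted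
  into the Poincare inequality of \<open>Y\<close>. All integrals are moved to the unit interval,
  where \<open>I\<close> carries the pointwise comparisons and its complement, of measure at most
  \<open>\<epsilon>\<close>, is handled by global bounds.\<close>

lemma variance_bound_of_close:
  fixes X :: "'a pm" and Y :: "'b pm"
  assumes X: "pm_space X" and Y: "pm_space Y" and p: "1 \<le> p" and q: "0 < q"
    and a: "pm_parameter X a" and b: "pm_parameter Y b"
    and I: "I \<in> sets unit_lebesgue" "1 - \<epsilon> \<le> measure unit_lebesgue I"
    and close: "\<And>s t. s \<in> I \<Longrightarrow> t \<in> I \<Longrightarrow> \<bar>pm_dist X (a s) (a t) - pm_dist Y (b s) (b t)\<bar> \<le> \<epsilon>"
    and c: "0 \<le> c" "poincare_const p q Y \<le> ennreal c"
    and f: "L > 0" "\<And>x y. x \<in> pm_points X \<Longrightarrow> y \<in> pm_points X \<Longrightarrow> \<bar>f x - f y\<bar> \<le> L * pm_dist X x y"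
      "\<And>x. x \<in> pm_points X \<Longrightarrow> \<bar>f x\<bar> \<le> M"
    and r: "r > 0" "\<eta> > 0" "0 < \<epsilon>" "\<epsilon> < 1" "\<epsilon> < r / 2" "8 * L * \<epsilon> \<le> \<eta> * r"
  shows "pm_variance p X f \<le>
    (c * ((\<integral>x. (lip_const (pm_metric X) (mball_of (pm_metric X) x (3 * r)) f + \<eta>) powr q \<partial>pm_measure X)
        + (3 * L + \<eta>) powr q * \<epsilon>) powr (1 / q)) powr p
    + p * (2 * M) powr (p - 1) * (2 * (2 * L + 2 * M)) * \<epsilon>"
proof -
  let ?U = unit_lebesgue
  interpret U: prob_space ?U by (rule prob_space_unit_lebesgue)
  have total: "U.prob {0..1} = 1" using U.prob_space by simp
  let ?G = "\<lambda>x. lip_const (pm_metric X) (mball_of (pm_metric X) x (3 * r)) f + \<eta>"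
  define K where "K = 3 * L + \<eta>"
  have K0: "0 < K" using f r by (simp add: K_def)
  have Isub: "I \<subseteq> space ?U" by (rule sets.sets_into_space[OF I(1)])
  have Ine: "I \<noteq> {}" using I(2) r by auto
  have aI: "a s \<in> pm_points X" and bI: "b s \<in> pm_points Y" if "s \<in> I" for s
    using that Isub pm_parameterD(2)[OF X a] pm_parameterD(2)[OF Y b] by auto
  obtain F where F:
    "\<And>y z. y \<in> pm_points Y \<Longrightarrow> z \<in> pm_points Y \<Longrightarrow> \<bar>F y - F z\<bar> \<le> (3 * L + \<eta>) * pm_dist Y y z"
    "\<And>y. y \<in> pm_points Y \<Longrightarrow> \<bar>F y\<bar> \<le> M"
    "\<And>t. t \<in> I \<Longrightarrow> \<bar>F (b t) - f (a t)\<bar> \<le> 2 * L * \<epsilon>"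
    "\<And>t. t \<in> I \<Longrightarrow> lip_a (pm_metric Y) F (b t) \<le> ?G (a t)"
    using local_lipschitz_transfer[of I a "pm_metric X" b "pm_metric Y" \<epsilon> L f M r \<eta>, OF Ine aI bI close f r(1,2) less_imp_le[OF r(3)] r(5,6)] by blast
  note FK = F(1)[folded K_def]
  have BF: "bounded_lipschitz (pm_metric Y) F" using F(1,2) by (rule bounded_lipschitzI)
  have Bf: "bounded_lipschitz (pm_metric X) f" using f(2,3) by (rule bounded_lipschitzI)
  note [measurable] = I(1) pm_parameterD(1)[OF X a] pm_parameterD(1)[OF Y b]
    bounded_lipschitz_measurable[OF X Bf] bounded_lipschitz_measurable[OF Y BF]
    lip_a_measurable[OF Y BF] lip_const_mball_measurable[OF X Bf]
  note intX = pm_parameterD(3)[OF X a] and intY = pm_parameterD(3)[OF Y b]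
  have L0: "0 \<le> L" using f(1) by simp
  have G: "0 \<le> ?G x" "?G x \<le> K" for x
    using lip_const_mball_bounds[OF L0 f(2), of x "3 * r"] f(1) r
    by (auto simp: K_def)
  have bnd: "integrable ?U h" if "h \<in> borel_measurable ?U" "\<And>s. s \<in> space ?U \<Longrightarrow> \<bar>h s\<bar> \<le> C"
    for h :: "real \<Rightarrow> real" and C
    using that by (intro U.integrable_const_bound[where B=C]) auto
  have fa: "\<bar>f (a s)\<bar> \<le> M" and Fb: "\<bar>F (b s)\<bar> \<le> M" if "s \<in> space ?U" for s
    using that pm_parameterD(2)[OF X a] pm_parameterD(2)[OF Y b] f(3) F(2) by auto
  define J where "J = space ?U - I"
  have J: "J \<inter> space ?U = J" by (auto simp: J_def)
  have [measurable]: "J \<in> sets ?U" unfolding J_def by measurable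
  have Jin: "s \<in> J" if "s \<notin> I" "s \<in> space ?U" for s using that by (simp add: J_def)
  have JnI: "s \<notin> J" if "s \<in> I" for s using that by (simp add: J_def)
  have compl: "(\<integral>s. indicator J s \<partial>?U) \<le> \<epsilon>"
    using U.prob_compl[OF I(1)] I(2) J by (simp only: Bochner_Integration.integral_indicator flip: J_def)
  have M0: "0 \<le> M" using Ine fa Isub by (meson abs_ge_zero ex_in_conv order_trans subsetD)

  define V where "V = pm_variance p Y F"
  define E where "E = (\<integral>y. lip_a (pm_metric Y) F y powr q \<partial>pm_measure Y)"
  have iG: "integrable ?U (\<lambda>s. ?G (a s) powr q)"
    using powr_mono2[OF less_imp_le[OF q] G] by (intro bnd[of _ "K powr q"]) auto
  have iJ: "integrable ?U (\<lambda>s. K powr q * indicator J s)"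
    by (intro bnd[of _ "K powr q"]) (auto simp: indicator_def)
  have "E = (\<integral>s. lip_a (pm_metric Y) F (b s) powr q \<partial>?U)" unfolding E_def by (rule intY) measurable
  \<comment> \<open>On \<open>I\<close> the local bound holds; on \<open>J\<close> only the global
    Lipschitz constant \<open>K\<close> of \<open>F\<close> is available.\<close>
  also have "\<dots> \<le> (\<integral>s. ?G (a s) powr q + K powr q * indicator J s \<partial>?U)"
  proof (rule integral_mono)
    have lipK: "0 \<le> lip_a (pm_metric Y) F y" "lip_a (pm_metric Y) F y \<le> K" for y
      using lip_a_nonneg[OF less_imp_le[OF K0] FK] lip_a_le_lipschitz[OF less_imp_le[OF K0] FK] by auto
    show "integrable ?U (\<lambda>s. lip_a (pm_metric Y) F (b s) powr q)"
      using lipK q by (intro bnd[of _ "K powr q"]) (auto intro!: powr_mono2)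
    show "integrable ?U (\<lambda>s. ?G (a s) powr q + K powr q * indicator J s)"
      by (rule Bochner_Integration.integrable_add[OF iG iJ])
    show "lip_a (pm_metric Y) F (b s) powr q \<le> ?G (a s) powr q + K powr q * indicator J s"
      if s: "s \<in> space ?U" for s
    proof (cases "s \<in> I")
      case True
      then show ?thesis using powr_mono2[OF less_imp_le[OF q] lipK(1) F(4)[OF True]] JnI by simp
    next
      case False
      have "lip_a (pm_metric Y) F (b s) powr q \<le> K powr q" using q lipK by (intro powr_mono2) auto
      then show ?thesis using Jin[OF False s] by (simp add: add_increasing)
    qed
  qed
  also have "\<dots> = (\<integral>s. ?G (a s) powr q \<partial>?U) + K powr q * (\<integral>s. indicator J s \<partial>?U)"
    using iG iJ by simp
  also have "(\<integral>s. ?G (a s) powr q \<partial>?U) = (\<integral>x. ?G x powr q \<partial>pm_measure X)"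
    by (rule intX[symmetric]) measurable
  also have "\<dots> + K powr q * (\<integral>s. indicator J s \<partial>?U) \<le> \<dots> + K powr q * \<epsilon>"
    using compl by (intro add_left_mono mult_left_mono) auto
  finally have E: "E \<le> (\<integral>x. ?G x powr q \<partial>pm_measure X) + K powr q * \<epsilon>" .

  have E0: "0 \<le> E" unfolding E_def by (rule integral_nonneg_AE) auto
  have V0: "0 \<le> V" unfolding V_def pm_variance_def by (rule integral_nonneg_AE) auto
  have "V powr (1 / p) \<le> c * E powr (1 / q)"
    using c(2) BF unfolding poincare_const_le_iff[OF c(1)] V_def E_def by blast
  also have "\<dots> \<le> c * ((\<integral>x. ?G x powr q \<partial>pm_measure X) + K powr q * \<epsilon>) powr (1 / q)"
    using E E0 c(1) q by (intro mult_left_mono powr_mono2) auto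
  finally have "(V powr (1 / p)) powr p \<le> \<dots> powr p" using p by (intro powr_mono2) auto
  moreover have "(V powr (1 / p)) powr p = V" using p V0 by (simp add: powr_powr)
  ultimately have V: "V \<le> (c * ((\<integral>x. ?G x powr q \<partial>pm_measure X) + K powr q * \<epsilon>) powr (1 / q)) powr p"
    by simp

  define mf mF where "mf = (\<integral>s. f (a s) \<partial>?U)" and "mF = (\<integral>s. F (b s) \<partial>?U)"
  \<comment> \<open>An L1 bound for \<open>f \<circ> a - F \<circ> b\<close>: the transfer error on
    \<open>I\<close>, and at most \<open>2 * M\<close> on the complement. It also bounds the
    difference of the means.\<close>
  define e where "e = 2 * L * \<epsilon> + 2 * M * \<epsilon>"
  have ifa: "integrable ?U (\<lambda>s. f (a s))" and iFb: "integrable ?U (\<lambda>s. F (b s))"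
    using fa Fb by (auto intro!: bnd[of _ M])
  have mf: "\<bar>mf\<bar> \<le> M" and mF: "\<bar>mF\<bar> \<le> M"
  proof -
    have avg: "\<bar>\<integral>s. h s \<partial>?U\<bar> \<le> M" if "integrable ?U h" "\<And>s. s \<in> space ?U \<Longrightarrow> \<bar>h s\<bar> \<le> M" for h :: "real \<Rightarrow> real"
    proof -
      have "\<bar>\<integral>s. h s \<partial>?U\<bar> \<le> (\<integral>s. \<bar>h s\<bar> \<partial>?U)" by (rule integral_abs_bound)
      also have "\<dots> \<le> (\<integral>s. M \<partial>?U)" using that by (intro integral_mono) auto
      finally show ?thesis by (simp add: total)
    qed
    show "\<bar>mf\<bar> \<le> M" "\<bar>mF\<bar> \<le> M" unfolding mf_def mF_def using ifa iFb fa Fb by (intro avg; simp)+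
  qed
  have idiff: "integrable ?U (\<lambda>s. \<bar>f (a s) - F (b s)\<bar>)" using ifa iFb by auto
  have diff: "(\<integral>s. \<bar>f (a s) - F (b s)\<bar> \<partial>?U) \<le> e"
  proof -
    have i2: "integrable ?U (\<lambda>s. 2 * M * indicator J s)"
      using M0 by (intro bnd[of _ "2 * M"]) (auto simp: indicator_def)
    have "(\<integral>s. \<bar>f (a s) - F (b s)\<bar> \<partial>?U) \<le> (\<integral>s. 2 * L * \<epsilon> + 2 * M * indicator J s \<partial>?U)"
    proof (rule integral_mono[OF idiff])
      show "\<bar>f (a s) - F (b s)\<bar> \<le> 2 * L * \<epsilon> + 2 * M * indicator J s" if s: "s \<in> space ?U" for s
      proof (cases "s \<in> I")
        case True
        then show ?thesis using F(3)[OF True] JnI by (simp add: abs_minus_commute)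
      next
        case False
        have "0 \<le> L * \<epsilon>" using L0 r by simp
        then show ?thesis using Jin[OF False s] fa[OF s] Fb[OF s] by simp
      qed
    qed (use i2 in auto)
    also have "\<dots> = 2 * L * \<epsilon> + 2 * M * (\<integral>s. indicator J s \<partial>?U)"
      using i2 by (subst Bochner_Integration.integral_add) (auto simp: total)
    also have "\<dots> \<le> e" unfolding e_def using compl M0 by (intro add_left_mono mult_left_mono) auto
    finally show ?thesis .
  qed
  have mdiff: "\<bar>mf - mF\<bar> \<le> e"
  proof -
    have "mf - mF = (\<integral>s. f (a s) - F (b s) \<partial>?U)" unfolding mf_def mF_def using ifa iFb by simp
    also have "\<bar>\<dots>\<bar> \<le> (\<integral>s. \<bar>f (a s) - F (b s)\<bar> \<partial>?U)" by (rule integral_abs_bound)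
    finally show ?thesis using diff by linarith
  qed
  \<comment> \<open>The constant of \<open>powr_diff_le\<close>, as deviations from the mean are at
    most \<open>2 * M\<close>.\<close>
  define \<kappa> where "\<kappa> = p * (2 * M) powr (p - 1)"
  have \<kappa>0: "0 \<le> \<kappa>" using p by (simp add: \<kappa>_def)
  have VX: "pm_variance p X f = (\<integral>s. \<bar>f (a s) - mf\<bar> powr p \<partial>?U)"
    unfolding pm_variance_def mf_def by (simp add: intX)
  have VY: "V = (\<integral>s. \<bar>F (b s) - mF\<bar> powr p \<partial>?U)"
    unfolding V_def pm_variance_def mF_def by (simp add: intY)
  have b2: "\<bar>f (a s) - mf\<bar> \<le> 2 * M" "\<bar>F (b s) - mF\<bar> \<le> 2 * M" if "s \<in> space ?U" for s
    using fa[OF that] Fb[OF that] mf mF by linarith+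
  have i1: "integrable ?U (\<lambda>s. \<bar>f (a s) - mf\<bar> powr p)" and i2: "integrable ?U (\<lambda>s. \<bar>F (b s) - mF\<bar> powr p)"
    using b2 p by (auto intro!: bnd[of _ "(2 * M) powr p"] powr_mono2)
  have "pm_variance p X f - V = (\<integral>s. \<bar>f (a s) - mf\<bar> powr p - \<bar>F (b s) - mF\<bar> powr p \<partial>?U)"
    unfolding VX VY using i1 i2 by simp
  also have "\<dots> \<le> (\<integral>s. \<kappa> * (\<bar>f (a s) - F (b s)\<bar> + e) \<partial>?U)"
  proof (rule integral_mono)
    show "\<bar>f (a s) - mf\<bar> powr p - \<bar>F (b s) - mF\<bar> powr p \<le> \<kappa> * (\<bar>f (a s) - F (b s)\<bar> + e)"
      if s: "s \<in> space ?U" for s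
    proof -
      have "\<bar>f (a s) - mf\<bar> powr p - \<bar>F (b s) - mF\<bar> powr p \<le> \<kappa> * \<bar>\<bar>f (a s) - mf\<bar> - \<bar>F (b s) - mF\<bar>\<bar>"
        unfolding \<kappa>_def using b2[OF s] p by (intro powr_diff_le) auto
      also have "\<dots> \<le> \<kappa> * (\<bar>f (a s) - F (b s)\<bar> + e)"
        using mdiff \<kappa>0 by (intro mult_left_mono) auto
      finally show ?thesis .
    qed
  qed (use i1 i2 idiff in auto)
  also have "\<dots> = \<kappa> * ((\<integral>s. \<bar>f (a s) - F (b s)\<bar> \<partial>?U) + e)"
    using idiff by (simp add: total)
  \<comment> \<open>One \<open>e\<close> accounts for the functions, the other for their
    means.\<close>
  also have "\<dots> \<le> \<kappa> * (e + e)" using diff \<kappa>0 by (intro mult_left_mono) auto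
  also have "\<dots> = p * (2 * M) powr (p - 1) * (2 * (2 * L + 2 * M)) * \<epsilon>"
    by (simp add: \<kappa>_def e_def algebra_simps)
  finally show ?thesis using V by (simp add: K_def)
qed

text \<open>Sequential content of lower semicontinuity: a bound shared by spaces arbitrarily
  box-close to \<open>X\<close> passes to \<open>X\<close>. For fixed \<open>r\<close> the global
  Lipschitz constant of \<open>F\<close> does not depend on the box error, so that error can vanish
  first; then \<open>r\<close> tends to 0.\<close>

lemma poincare_const_le_of_box_limit:
  fixes X :: "'a pm"
  assumes X: "pm_space X" and p: "1 \<le> p" and q: "0 < q" and c: "0 \<le> c"
    and approx: "\<And>\<epsilon>. \<epsilon> > 0 \<Longrightarrow>
      \<exists>Y :: 'b pm. pm_space Y \<and> box_dist X Y < ennreal \<epsilon> \<and> poincare_const p q Y \<le> ennreal c"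
  shows "poincare_const p q X \<le> ennreal c"
  unfolding poincare_const_le_iff[OF c]
proof (intro allI impI)
  fix f assume Bf: "bounded_lipschitz (pm_metric X) f"
  interpret P: prob_space "pm_measure X" using X by (simp add: pm_space_def)
  obtain L M where f: "L > 0" "\<And>x y. x \<in> pm_points X \<Longrightarrow> y \<in> pm_points X \<Longrightarrow> \<bar>f x - f y\<bar> \<le> L * pm_dist X x y"
      "\<And>x. x \<in> pm_points X \<Longrightarrow> \<bar>f x\<bar> \<le> M"
    using bounded_lipschitzE[OF Bf] by metis
  define G where "G r x = lip_const (pm_metric X) (mball_of (pm_metric X) x (3 * r)) f" for r x
  \<comment> \<open>The extra slope \<open>\<eta>\<close> is taken equal to \<open>r\<close>, so one
    limit removes both.\<close>
  define A where "A r = (\<integral>x. (G r x + r) powr q \<partial>pm_measure X)" for r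
  define E where "E = (\<integral>x. lip_a (pm_metric X) f x powr q \<partial>pm_measure X)"
  have A0: "0 \<le> A r" for r unfolding A_def by (rule integral_nonneg_AE) auto
  have E0: "0 \<le> E" unfolding E_def by (rule integral_nonneg_AE) auto
  have scale: "pm_variance p X f \<le> (c * A r powr (1 / q)) powr p" if r: "r > 0" for r
  proof -
    let ?B = "\<lambda>\<epsilon>. (c * (A r + (3 * L + r) powr q * \<epsilon>) powr (1 / q)) powr p
      + p * (2 * M) powr (p - 1) * (2 * (2 * L + 2 * M)) * \<epsilon>"
    \<comment> \<open>Collects the smallness conditions of \<open>variance_bound_of_close\<close>
      for \<open>\<eta> = r\<close>.\<close>
    define \<epsilon>0 where "\<epsilon>0 = min 1 (min (r / 2) (r * r / (8 * L)))"
    have \<epsilon>0: "\<epsilon>0 > 0" using r f(1) by (simp add: \<epsilon>0_def)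
    have bound: "pm_variance p X f \<le> ?B \<epsilon>" if \<epsilon>: "0 < \<epsilon>" "\<epsilon> < \<epsilon>0" for \<epsilon>
    proof -
      have small: "\<epsilon> < 1" "\<epsilon> < r / 2" "\<epsilon> < r * r / (8 * L)" using \<epsilon>(2) by (simp_all add: \<epsilon>0_def)
      have "8 * L * \<epsilon> \<le> r * r" using small(3) f(1) by (simp add: field_simps)
      moreover obtain Y :: "'b pm" where Y: "pm_space Y" "box_dist X Y < ennreal \<epsilon>" "poincare_const p q Y \<le> ennreal c"
        using approx[OF \<epsilon>(1)] by blast
      \<comment> \<open>The infimum yields parameters for some \<open>e < \<epsilon>\<close>; the
        measure and distance conditions only weaken when \<open>e\<close> is replaced by
        \<open>\<epsilon>\<close>.\<close>
      moreover obtain e a b I where e: "ennreal e < ennreal \<epsilon>" "0 < e" "pm_parameter X a" "pm_parameter Y b"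
         "I \<in> sets unit_lebesgue" "measure unit_lebesgue I \<ge> 1 - e"
         "\<And>s t. s \<in> I \<Longrightarrow> t \<in> I \<Longrightarrow> \<bar>pm_dist X (a s) (a t) - pm_dist Y (b s) (b t)\<bar> \<le> e"
        using Y(2) unfolding box_dist_def Inf_less_iff by blast
      moreover have "e < \<epsilon>" using e(1,2) by (simp add: ennreal_less_iff)
      ultimately show ?thesis
        unfolding A_def G_def using variance_bound_of_close[OF X Y(1) p q e(3,4,5), of \<epsilon> c L f M r r]
          f c r \<epsilon> small by (smt (verit, best))
    qed
    have "(?B \<longlongrightarrow> (c * (A r + (3 * L + r) powr q * 0) powr (1 / q)) powr p
      + p * (2 * M) powr (p - 1) * (2 * (2 * L + 2 * M)) * 0) (at_right 0)"
    \<comment> \<open>The bases may tend to 0, so continuity of \<open>powr\<close> rests on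
      positive exponents and eventually nonnegative bases.\<close>
    proof (intro tendsto_intros tendsto_powr' disjI2 conjI)
      show "\<forall>\<^sub>F \<epsilon> in at_right 0. 0 \<le> A r + (3 * L + r) powr q * \<epsilon>"
        using A0[of r] by (auto simp: eventually_at_right_field intro!: exI[of _ 1] add_nonneg_nonneg)
      show "\<forall>\<^sub>F \<epsilon> in at_right 0. 0 \<le> c * (A r + (3 * L + r) powr q * \<epsilon>) powr (1 / q)"
        using c by simp
    qed (use p q in auto)
    moreover have "\<forall>\<^sub>F \<epsilon> in at_right 0. pm_variance p X f \<le> ?B \<epsilon>"
      using bound \<epsilon>0 unfolding eventually_at_right_field by blast
    ultimately show ?thesis using tendsto_lowerbound[of ?B _ "at_right 0"] by simp
  qed
  define \<rho> :: "nat \<Rightarrow> real" where "\<rho> = (\<lambda>n. inverse (real (Suc n)))"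
  have \<rho>: "\<rho> n > 0" "\<rho> n \<le> 1" "\<rho> \<longlonglongrightarrow> 0" for n
    unfolding \<rho>_def by (simp, simp add: inverse_eq_divide, rule LIMSEQ_inverse_real_of_nat)
  have L0: "0 \<le> L" using f(1) by simp
  have G: "0 \<le> G r x" "G r x \<le> L" for r x
    unfolding G_def using lip_const_mball_bounds[OF L0 f(2)] by auto
  note [measurable] = lip_a_measurable[OF X Bf] lip_const_mball_measurable[OF X Bf]
  have "(\<lambda>n. A (\<rho> n)) \<longlonglongrightarrow> E"
    unfolding A_def E_def
  \<comment> \<open>The constant dominates because the ball constants are at most \<open>L\<close>
    and \<open>\<rho> n \<le> 1\<close>.\<close>
  proof (rule integral_dominated_convergence[where w="\<lambda>x. (L + 1) powr q"])
    show "AE x in pm_measure X. (\<lambda>n. (G (\<rho> n) x + \<rho> n) powr q) \<longlonglongrightarrow> lip_a (pm_metric X) f x powr q"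
    proof (rule AE_I2)
      fix x
      have "(\<lambda>n. 3 * \<rho> n) \<longlonglongrightarrow> 0" using tendsto_mult_right_zero[OF \<rho>(3)] by simp
      then have "(\<lambda>n. G (\<rho> n) x) \<longlonglongrightarrow> lip_a (pm_metric X) f x"
        unfolding G_def using \<rho>(1) by (intro lip_const_mball_tendsto[OF L0 f(2)]) auto
      then have "(\<lambda>n. G (\<rho> n) x + \<rho> n) \<longlonglongrightarrow> lip_a (pm_metric X) f x"
        using tendsto_add[OF _ \<rho>(3)] by fastforce
      moreover have "0 \<le> G (\<rho> n) x + \<rho> n" for n
        using G(1) \<rho>(1)[of n] by (simp add: add_nonneg_nonneg less_imp_le)
      ultimately show "(\<lambda>n. (G (\<rho> n) x + \<rho> n) powr q) \<longlonglongrightarrow> lip_a (pm_metric X) f x powr q"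
        using q by (intro tendsto_powr') auto
    qed
    show "AE x in pm_measure X. norm ((G (\<rho> n) x + \<rho> n) powr q) \<le> (L + 1) powr q" for n
    proof (rule AE_I2)
      fix x
      show "norm ((G (\<rho> n) x + \<rho> n) powr q) \<le> (L + 1) powr q"
        using G[of "\<rho> n" x] \<rho>(1,2)[of n] q by (auto intro!: powr_mono2)
    qed
  qed (auto simp: G_def)
  then have "(\<lambda>n. (c * A (\<rho> n) powr (1 / q)) powr p) \<longlonglongrightarrow> (c * E powr (1 / q)) powr p"
    using p q A0 c by (intro tendsto_powr' tendsto_intros disjI2 conjI) auto
  then have "pm_variance p X f \<le> (c * E powr (1 / q)) powr p"
    by (rule LIMSEQ_le_const) (use scale \<rho>(1) in auto)
  moreover have "0 \<le> pm_variance p X f" unfolding pm_variance_def by (rule integral_nonneg_AE) auto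
  ultimately have "pm_variance p X f powr (1 / p) \<le> ((c * E powr (1 / q)) powr p) powr (1 / p)"
    using p by (intro powr_mono2) auto
  also have "\<dots> = c * E powr (1 / q)" using p c by (simp add: powr_powr)
  finally show "pm_variance p X f powr (1 / p) \<le> c * E powr (1 / q)" .
qed

text \<open>If no box ball around the class stays in the superlevel set, every ball contains a class
  with constant at most \<open>c\<close>, and the preceding lemma gives the same bound at the
  centre.\<close>

lemma class_poincare_const_lower_semicontinuous:
  assumes p: "1 \<le> p" and q: "0 < q"
  shows "lower_semicontinuous box_topology (class_poincare_const p q)"
  unfolding lower_semicontinuous_def openin_box_topology topspace_box_topology
proof (intro allI conjI ballI)
  fix c \<X> assume \<X>: "\<X> \<in> {\<X> \<in> pm_classes. c < class_poincare_const p q \<X>}"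
  \<comment> \<open>\<open>c\<close> is finite, being strictly below another value.\<close>
  then obtain c' where c': "c = ennreal c'" "0 \<le> c'" by (cases c) auto
  show "\<exists>r>0. {\<Y> \<in> pm_classes. class_box_dist \<X> \<Y> < ennreal r}
      \<subseteq> {\<X> \<in> pm_classes. c < class_poincare_const p q \<X>}"
  proof (rule ccontr)
    assume neg: "\<not> ?thesis"
    have "poincare_const p q (pm_rep \<X>) \<le> ennreal c'"
    proof (rule poincare_const_le_of_box_limit[OF _ p q c'(2)])
      show "pm_space (pm_rep \<X>)" using \<X> pm_rep(2) by blast
      fix \<epsilon> :: real assume "\<epsilon> > 0"
      then obtain \<Y> where "\<Y> \<in> pm_classes" "class_box_dist \<X> \<Y> < ennreal \<epsilon>"
        "\<not> c < class_poincare_const p q \<Y>" using neg by blast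
      then show "\<exists>Y :: real_pm. pm_space Y \<and> box_dist (pm_rep \<X>) Y < ennreal \<epsilon>
          \<and> poincare_const p q Y \<le> ennreal c'"
        using pm_rep(2) c'(1)
        by (intro exI[of _ "pm_rep \<Y>"]) (auto simp: class_box_dist_def class_poincare_const_def not_less)
    qed
    then show False using \<X> c'(1) leD unfolding class_poincare_const_def by blast
  qed
qed auto

theorem theorem4p12:
  fixes p q :: real
  assumes "1 \<le> p" and "1 \<le> q"
    and "(1 < p \<and> p \<le> q) \<or> (p = 1 \<and> 1 < q)"
  shows "class_monotone (class_poincare_const p q) \<and>
         class_1_homogeneous (class_poincare_const p q) \<and>
         lower_semicontinuous box_topology (class_poincare_const p q)"
  using assms(1,2) class_poincare_const_monotone[of q p] class_poincare_const_1_homogeneous[of q p]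
    class_poincare_const_lower_semicontinuous[of p q]
  by simp

end
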